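(* Let $n-m\ge 1$ and let $\mathbf G=G_0+G_1\mathbf i+G_2\mathbf j+G_3\mathbf k\in\mathbb Q^{m\times n}$ be a quaternion random matrix, where $G_0,G_1,G_2,G_3$ are real $m\times n$ matrices all of whose entries are independent $N(0,1)$ random variables. Then for each $t\ge 1$, $$\mathsf P\left\{\|\mathbf G^\dagger\|_F^2>\frac{3m}{4(n-m+1)}\,t\right\}\le t^{-2(n-m)}.$$
   Context: $\mathbb Q$ denotes the real quaternions with imaginary units $\mathbf i,\mathbf j,\mathbf k$. $\mathbf G^\dagger$ is the Moore–Penrose pseudoinverse, and $\|\mathbf M\|_F=(\sum_{i,j}|\mathbf m_{ij}|^2)^{1/2}$ is the Frobenius norm, with $|\cdot|$ the quaternion modulus. *)

theory Defs
  imports "HOL-Probability.Probability"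
begin

section \<open>Real quaternions\<close>

text \<open>\<open>Quat a b c d\<close> is the quaternion \<open>a + b i + c j + d k\<close>; see \<open>Quat_eq\<close> below.\<close>

datatype quat = Quat (qre: real) (qi: real) (qj: real) (qk: real)

lemma quat_eq_iff: "p = q \<longleftrightarrow> qre p = qre q \<and> qi p = qi q \<and> qj p = qj q \<and> qk p = qk q"
  by (cases p; cases q) simp

instantiation quat :: real_vector
begin

definition zero_quat :: quat where "0 = Quat 0 0 0 0"

definition plus_quat :: "quat \<Rightarrow> quat \<Rightarrow> quat" where
  "p + q = Quat (qre p + qre q) (qi p + qi q) (qj p + qj q) (qk p + qk q)"

definition minus_quat :: "quat \<Rightarrow> quat \<Rightarrow> quat" where
  "p - q = Quat (qre p - qre q) (qi p - qi q) (qj p - qj q) (qk p - qk q)"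

definition uminus_quat :: "quat \<Rightarrow> quat" where
  "- q = Quat (- qre q) (- qi q) (- qj q) (- qk q)"

definition scaleR_quat :: "real \<Rightarrow> quat \<Rightarrow> quat" where
  "r *\<^sub>R q = Quat (r * qre q) (r * qi q) (r * qj q) (r * qk q)"

instance
  by standard
    (simp_all add: quat_eq_iff zero_quat_def plus_quat_def minus_quat_def uminus_quat_def
      scaleR_quat_def algebra_simps)

end

instantiation quat :: real_algebra_1
begin

definition one_quat :: quat where "1 = Quat 1 0 0 0"

definition times_quat :: "quat \<Rightarrow> quat \<Rightarrow> quat" where
  "p * q = Quat
     (qre p * qre q - qi p * qi q - qj p * qj q - qk p * qk q)
     (qre p * qi q + qi p * qre q + qj p * qk q - qk p * qj q)
     (qre p * qj q - qi p * qk q + qj p * qre q + qk p * qi q)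
     (qre p * qk q + qi p * qj q - qj p * qi q + qk p * qre q)"

instance
  by standard
    (simp_all add: quat_eq_iff zero_quat_def plus_quat_def scaleR_quat_def one_quat_def
      times_quat_def algebra_simps)

end

lemma zero_quat_sel [simp]: "qre 0 = 0" "qi 0 = 0" "qj 0 = 0" "qk 0 = 0"
  by (simp_all add: zero_quat_def)

lemma one_quat_sel [simp]: "qre 1 = 1" "qi 1 = 0" "qj 1 = 0" "qk 1 = 0"
  by (simp_all add: one_quat_def)

lemma plus_quat_sel [simp]:
  "qre (p + q) = qre p + qre q" "qi (p + q) = qi p + qi q"
  "qj (p + q) = qj p + qj q" "qk (p + q) = qk p + qk q"
  by (simp_all add: plus_quat_def)

lemma minus_quat_sel [simp]:
  "qre (p - q) = qre p - qre q" "qi (p - q) = qi p - qi q"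
  "qj (p - q) = qj p - qj q" "qk (p - q) = qk p - qk q"
  by (simp_all add: minus_quat_def)

lemma uminus_quat_sel [simp]:
  "qre (- q) = - qre q" "qi (- q) = - qi q" "qj (- q) = - qj q" "qk (- q) = - qk q"
  by (simp_all add: uminus_quat_def)

lemma scaleR_quat_sel [simp]:
  "qre (r *\<^sub>R q) = r * qre q" "qi (r *\<^sub>R q) = r * qi q"
  "qj (r *\<^sub>R q) = r * qj q" "qk (r *\<^sub>R q) = r * qk q"
  by (simp_all add: scaleR_quat_def)

lemma times_quat_sel:
  "qre (p * q) = qre p * qre q - qi p * qi q - qj p * qj q - qk p * qk q"
  "qi (p * q) = qre p * qi q + qi p * qre q + qj p * qk q - qk p * qj q"
  "qj (p * q) = qre p * qj q - qi p * qk q + qj p * qre q + qk p * qi q"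
  "qk (p * q) = qre p * qk q + qi p * qj q - qj p * qi q + qk p * qre q"
  by (simp_all add: times_quat_def)

definition iq :: quat where "iq = Quat 0 1 0 0"
definition jq :: quat where "jq = Quat 0 0 1 0"
definition kq :: quat where "kq = Quat 0 0 0 1"

lemma quat_units:
  "iq * iq = -1" "jq * jq = -1" "kq * kq = -1" "iq * jq * kq = -1"
  by (simp_all add: quat_eq_iff times_quat_sel iq_def jq_def kq_def)

lemma Quat_eq: "Quat a b c d = of_real a + of_real b * iq + of_real c * jq + of_real d * kq"
  by (simp add: quat_eq_iff times_quat_sel iq_def jq_def kq_def of_real_def)

definition qcnj :: "quat \<Rightarrow> quat" where
  "qcnj q = Quat (qre q) (- qi q) (- qj q) (- qk q)"

lemma qcnj_sel [simp]:
  "qre (qcnj q) = qre q" "qi (qcnj q) = - qi q" "qj (qcnj q) = - qj q" "qk (qcnj q) = - qk q"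
  by (simp_all add: qcnj_def)

lemma qcnj_0 [simp]: "qcnj 0 = 0"
  by (simp add: quat_eq_iff)

lemma qcnj_add: "qcnj (p + q) = qcnj p + qcnj q"
  by (simp add: quat_eq_iff)

lemma qcnj_mult: "qcnj (p * q) = qcnj q * qcnj p"
  by (simp add: quat_eq_iff times_quat_sel algebra_simps)

lemma qcnj_qcnj [simp]: "qcnj (qcnj q) = q"
  by (simp add: quat_eq_iff)

lemma qcnj_sum: "qcnj (sum f A) = (\<Sum>x\<in>A. qcnj (f x))"
  by (induction A rule: infinite_finite_induct) (simp_all add: qcnj_add)

text \<open>The norm of the type is the quaternion modulus.\<close>

instantiation quat :: real_normed_div_algebra
begin

definition norm_quat :: "quat \<Rightarrow> real" where
  "norm q = sqrt ((qre q)\<^sup>2 + (qi q)\<^sup>2 + (qj q)\<^sup>2 + (qk q)\<^sup>2)"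

definition sgn_quat_def: "sgn (q :: quat) = q /\<^sub>R norm q"

definition dist_quat_def: "dist (p :: quat) q = norm (p - q)"

definition uniformity_quat_def:
  "(uniformity :: (quat \<times> quat) filter) = (INF e\<in>{0 <..}. principal {(x, y). dist x y < e})"

definition open_quat_def:
  "open (U :: quat set) \<longleftrightarrow> (\<forall>x\<in>U. eventually (\<lambda>(x', y). x' = x \<longrightarrow> y \<in> U) uniformity)"

definition inverse_quat :: "quat \<Rightarrow> quat" where
  "inverse q = qcnj q /\<^sub>R (norm q)\<^sup>2"

definition divide_quat_def:
  "(p :: quat) div q = p * inverse q"

instance
proof
  fix p q :: quat and r :: real
  have norm2: "(norm q)\<^sup>2 = (qre q)\<^sup>2 + (qi q)\<^sup>2 + (qj q)\<^sup>2 + (qk q)\<^sup>2" for q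
    by (simp add: norm_quat_def)
  show norm0: "norm q = 0 \<longleftrightarrow> q = 0" for q :: quat
    by (simp add: norm_quat_def quat_eq_iff add_nonneg_eq_0_iff)
  have cnj: "q * qcnj q = (norm q)\<^sup>2 *\<^sub>R 1" "qcnj q * q = (norm q)\<^sup>2 *\<^sub>R 1" for q :: quat
    by (simp_all add: quat_eq_iff times_quat_sel norm2) (simp_all add: power2_eq_square)
  show "q \<noteq> 0 \<Longrightarrow> inverse q * q = 1" "q \<noteq> 0 \<Longrightarrow> q * inverse q = 1"
    by (simp_all add: inverse_quat_def cnj norm0)
  show "p div q = p * inverse q"
    by (rule divide_quat_def)
  show "inverse (0::quat) = 0"
    by (simp add: inverse_quat_def)
  show "norm (p * q) = norm p * norm q"
    unfolding norm_quat_def real_sqrt_mult [symmetric] real_sqrt_eq_iff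
    by (simp add: times_quat_sel power2_eq_square algebra_simps)
  show "norm (r *\<^sub>R q) = \<bar>r\<bar> * norm q"
    unfolding norm_quat_def real_sqrt_abs [symmetric] real_sqrt_mult [symmetric] real_sqrt_eq_iff
    by (simp add: power2_eq_square algebra_simps)
  show "norm (p + q) \<le> norm p + norm q"
  proof -
    have L2: "norm q = L2_set (\<lambda>c. [qre q, qi q, qj q, qk q] ! c) {..<4}" for q
      by (simp add: norm_quat_def L2_set_def numeral_eq_Suc lessThan_Suc algebra_simps)
    have "norm (p + q) = L2_set (\<lambda>c. [qre p, qi p, qj p, qk p] ! c + [qre q, qi q, qj q, qk q] ! c) {..<4}"
      by (simp add: norm_quat_def L2_set_def numeral_eq_Suc lessThan_Suc algebra_simps)
    also have "\<dots> \<le> norm p + norm q"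
      unfolding L2 by (rule L2_set_triangle_ineq)
    finally show ?thesis .
  qed
qed (rule sgn_quat_def dist_quat_def uniformity_quat_def open_quat_def norm_quat_def)+

end


instantiation quat :: real_inner
begin

definition inner_quat :: "quat \<Rightarrow> quat \<Rightarrow> real" where
  "p \<bullet> q = qre p * qre q + qi p * qi q + qj p * qj q + qk p * qk q"

instance
proof
  fix p q s :: quat and r :: real
  show "p \<bullet> q = q \<bullet> p" "(p + q) \<bullet> s = p \<bullet> s + q \<bullet> s" "(r *\<^sub>R p) \<bullet> q = r * (p \<bullet> q)"
    by (simp_all add: inner_quat_def algebra_simps)
  show "0 \<le> p \<bullet> p"
    by (simp add: inner_quat_def)
  show "p \<bullet> p = 0 \<longleftrightarrow> p = 0"
    by (simp add: inner_quat_def quat_eq_iff add_nonneg_eq_0_iff)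
  show "norm p = sqrt (p \<bullet> p)"
    by (simp add: inner_quat_def norm_quat_def power2_eq_square)
qed

end


section \<open>Quaternion matrices\<close>

definition quat_matrix ::
  "real^'n^'m \<Rightarrow> real^'n^'m \<Rightarrow> real^'n^'m \<Rightarrow> real^'n^'m \<Rightarrow> quat^'n^'m" where
  "quat_matrix A B C D = (\<chi> i j. Quat (A $ i $ j) (B $ i $ j) (C $ i $ j) (D $ i $ j))"

definition hermitian :: "quat^'n^'m \<Rightarrow> quat^'m^'n" where
  "hermitian A = (\<chi> i j. qcnj (A $ j $ i))"

lemma hermitian_mult:
  fixes A :: "quat^'n^'m" and B :: "quat^'p^'n"
  shows "hermitian (A ** B) = hermitian B ** hermitian A"
  by (simp add: hermitian_def matrix_matrix_mult_def vec_eq_iff qcnj_sum qcnj_mult)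

definition is_pseudoinverse :: "quat^'n^'m \<Rightarrow> quat^'m^'n \<Rightarrow> bool" where
  "is_pseudoinverse A X \<longleftrightarrow>
     A ** X ** A = A \<and> X ** A ** X = X \<and>
     hermitian (A ** X) = A ** X \<and> hermitian (X ** A) = X ** A"

lemma is_pseudoinverse_unique:
  assumes "is_pseudoinverse A X" "is_pseudoinverse A Y"
  shows "X = Y"
proof -
  have X: "A ** X ** A = A" "X ** A ** X = X" "hermitian (A ** X) = A ** X" "hermitian (X ** A) = X ** A"
    and Y: "A ** Y ** A = A" "Y ** A ** Y = Y" "hermitian (A ** Y) = A ** Y" "hermitian (Y ** A) = Y ** A"
    using assms by (auto simp: is_pseudoinverse_def)
  have "A ** X = hermitian ((A ** Y) ** (A ** X))"
    using X Y by (simp add: matrix_mul_assoc)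
  also have "\<dots> = (A ** X) ** (A ** Y)"
    by (simp only: hermitian_mult [of "A ** Y"] X Y)
  also have "\<dots> = A ** Y"
    using X by (simp add: matrix_mul_assoc)
  finally have AX: "A ** X = A ** Y" .
  have "X ** A = hermitian ((X ** A) ** (Y ** A))"
    using X Y by (metis matrix_mul_assoc)
  also have "\<dots> = (Y ** A) ** (X ** A)"
    by (simp only: hermitian_mult [of "X ** A"] X Y)
  also have "\<dots> = Y ** A"
    using X by (metis matrix_mul_assoc)
  finally have XA: "X ** A = Y ** A" .
  show ?thesis
    by (metis AX XA X(2) Y(2) matrix_mul_assoc)
qed

text \<open>Every quaternion matrix has exactly one pseudoinverse, so the description is proper;
  uniqueness is \<open>is_pseudoinverse_unique\<close>.\<close>

definition pseudoinverse :: "quat^'n^'m \<Rightarrow> quat^'m^'n" where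
  "pseudoinverse A = (THE X. is_pseudoinverse A X)"

definition frobenius_norm :: "quat^'n^'m \<Rightarrow> real" where
  "frobenius_norm A = sqrt (\<Sum>i\<in>UNIV. \<Sum>j\<in>UNIV. (norm (A $ i $ j))\<^sup>2)"

end

theory Submission
  imports Defs
begin

text \<open>Let \<open>k = n - m + 1\<close> and \<open>q = 2 k - 2\<close>. Let \<open>X\<^sub>i\<close> be the squared distance of the \<open>i\<close>-th row of \<open>G\<close> to the
  left span of the other rows. If all \<open>X\<^sub>i\<close> are positive, then \<open>\<parallel>G\<^sup>\<dagger>\<parallel>\<^sub>F\<^sup>2 = \<Sum>\<^sub>i 1 / X\<^sub>i\<close>. Conditionally on the other
  rows, whose span has real dimension at most \<open>4 (m - 1)\<close>, rotation invariance of the Gaussian measure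
  shows that \<open>X\<^sub>i\<close> dominates a chi-square variable with \<open>4 k\<close> degrees of freedom. Writing
  \<open>x\<close> to the power \<open>-q\<close> as a Laplace transform, this bounds the expectation of \<open>1 / X\<^sub>i\<close> to the power \<open>q\<close> by
  \<open>1 / (2^q * (2 k - 1)!)\<close>. Convexity of \<open>x^q\<close>, Markov's inequality and
  \<open>(2 k / 3)^q \<le> (2 k - 1)!\<close> finish the proof.\<close>

section \<open>The standard Gaussian measure on a Euclidean space\<close>

text \<open>By uniqueness of translation-invariant measures: with \<open>\<mu>\<close> the image measure and \<open>B\<close> the unit ball,
  Tonelli and the substitutions \<open>x \<mapsto> x + y\<close>, \<open>y \<mapsto> y - x\<close> give
  \<open>\<mu> A * lborel B = lborel A * \<mu> B\<close>, and \<open>\<mu> B = lborel B\<close> since an isometry preserves balls.\<close>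

lemma lborel_distr_isometry:
  fixes f :: "'a::euclidean_space \<Rightarrow> 'a"
  assumes f: "orthogonal_transformation f"
  shows "distr lborel borel f = lborel"
proof -
  have lin: "linear f"
    using f by (simp add: orthogonal_transformation_def)
  have [measurable]: "f \<in> borel_measurable borel"
    using lin by (intro borel_measurable_continuous_onI linear_continuous_on linear_conv_bounded_linear[THEN iffD1])
  define \<mu> where "\<mu> = distr lborel borel f"
  have sets_\<mu> [measurable_cong, simp]: "sets \<mu> = sets borel"
    by (simp add: \<mu>_def)
  have space_\<mu> [simp]: "space \<mu> = UNIV"
    by (simp add: \<mu>_def)
  have vim: "f -` ball 0 r = ball 0 r" for r
    using f by (auto simp: orthogonal_transformation)
  have ball: "emeasure \<mu> (ball 0 r) = emeasure lborel (ball (0::'a) r)" for r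
    by (simp add: \<mu>_def emeasure_distr vim)
  \<comment> \<open>Tonelli's theorem needs this. Balls around \<open>0\<close> are their own
    preimages, so \<open>\<mu>\<close> gives them their finite Lebesgue volume.\<close>
  have sf: "sigma_finite_measure \<mu>"
  proof (intro sigma_finite_measure.intro exI conjI ballI)
    show "countable (range (\<lambda>n::nat. ball (0::'a) n))" by simp
    show "range (\<lambda>n::nat. ball (0::'a) n) \<subseteq> sets \<mu>" by auto
    show "\<Union> (range (\<lambda>n::nat. ball (0::'a) n)) = space \<mu>"
      by (auto intro: reals_Archimedean2)
    show "emeasure \<mu> A \<noteq> \<infinity>" if "A \<in> range (\<lambda>n::nat. ball (0::'a) n)" for A
      using that emeasure_lborel_ball_finite[of "0::'a"] by (auto simp: ball order.strict_iff_not top_unique)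
  qed
  interpret pair_sigma_finite \<mu> "lborel :: 'a measure"
    using sf sigma_finite_lborel by (rule pair_sigma_finite.intro)
  have inv_lborel: "(\<integral>\<^sup>+y. h (c + y) \<partial>lborel) = (\<integral>\<^sup>+y. h y \<partial>lborel)"
    if [measurable]: "h \<in> borel_measurable borel" for h :: "'a \<Rightarrow> ennreal" and c
    by (subst (2) lborel_distr_plus[of c, symmetric]) (simp add: nn_integral_distr)
  have inv_\<mu>: "(\<integral>\<^sup>+x. h (x + c) \<partial>\<mu>) = (\<integral>\<^sup>+x. h x \<partial>\<mu>)"
    if [measurable]: "h \<in> borel_measurable borel" for h :: "'a \<Rightarrow> ennreal" and c
  proof -
    \<comment> \<open>By linearity, shifting by \<open>c\<close> after \<open>f\<close> is shifting
      by \<open>d\<close> before \<open>f\<close>.\<close>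
    obtain d where d: "c = f d"
      using orthogonal_transformation_surj[OF f] by (auto simp: surj_def)
    have "(\<integral>\<^sup>+x. h (x + c) \<partial>\<mu>) = (\<integral>\<^sup>+x. h (f (d + x)) \<partial>lborel)"
      by (simp add: \<mu>_def nn_integral_distr d linear_add[OF lin] add.commute)
    also have "\<dots> = (\<integral>\<^sup>+x. h (f x) \<partial>lborel)"
      using inv_lborel[of "\<lambda>x. h (f x)" d] by simp
    also have "\<dots> = (\<integral>\<^sup>+x. h x \<partial>\<mu>)"
      by (simp add: \<mu>_def nn_integral_distr)
    finally show ?thesis .
  qed
  define B where "B = ball (0::'a) 1"
  have [measurable]: "B \<in> sets borel" by (simp add: B_def)
  \<comment> \<open>Symmetry of the ball makes \<open>indicator B (y - x)\<close> a translate of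
    \<open>B\<close> in the variable \<open>x\<close>, so its \<open>\<mu>\<close>-integral is
    \<open>\<mu> B\<close>.\<close>
  have sym: "indicator B (y - x) = (indicator B (x - y) :: ennreal)" for x y
    by (auto simp: B_def indicator_def norm_minus_commute)
  have "emeasure \<mu> A = emeasure lborel A" if [measurable]: "A \<in> sets borel" for A
  proof -
    have "emeasure \<mu> A * emeasure lborel B = (\<integral>\<^sup>+x. \<integral>\<^sup>+y. indicator A x * indicator B y \<partial>lborel \<partial>\<mu>)"
      by (simp add: nn_integral_cmult nn_integral_multc)
    also have "\<dots> = (\<integral>\<^sup>+y. \<integral>\<^sup>+x. indicator A x * indicator B y \<partial>\<mu> \<partial>lborel)"
      by (rule Fubini'[symmetric]) simp
    also have "\<dots> = (\<integral>\<^sup>+y. \<integral>\<^sup>+x. indicator A (x + y) * indicator B y \<partial>\<mu> \<partial>lborel)"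
    proof (rule nn_integral_cong)
      fix y
      show "(\<integral>\<^sup>+x. indicator A x * indicator B y \<partial>\<mu>) = (\<integral>\<^sup>+x. indicator A (x + y) * indicator B y \<partial>\<mu>)"
        using inv_\<mu>[of "\<lambda>x. indicator A x * indicator B y" y] by simp
    qed
    also have "\<dots> = (\<integral>\<^sup>+x. \<integral>\<^sup>+y. indicator A (x + y) * indicator B y \<partial>lborel \<partial>\<mu>)"
      by (rule Fubini') simp
    also have "\<dots> = (\<integral>\<^sup>+x. \<integral>\<^sup>+y. indicator A y * indicator B (y - x) \<partial>lborel \<partial>\<mu>)"
    proof (rule nn_integral_cong)
      fix x
      show "(\<integral>\<^sup>+y. indicator A (x + y) * indicator B y \<partial>lborel) = (\<integral>\<^sup>+y. indicator A y * indicator B (y - x) \<partial>lborel)"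
        using inv_lborel[of "\<lambda>y. indicator A y * indicator B (y - x)" x] by simp
    qed
    also have "\<dots> = (\<integral>\<^sup>+y. \<integral>\<^sup>+x. indicator A y * indicator B (y - x) \<partial>\<mu> \<partial>lborel)"
      by (rule Fubini'[symmetric]) simp
    also have "\<dots> = (\<integral>\<^sup>+y. indicator A y * emeasure \<mu> B \<partial>lborel)"
    proof (rule nn_integral_cong)
      fix y
      have "(\<integral>\<^sup>+x. indicator B (x - y) \<partial>\<mu>) = emeasure \<mu> B"
        using inv_\<mu>[of "indicator B" "- y"] by simp
      then show "(\<integral>\<^sup>+x. indicator A y * indicator B (y - x) \<partial>\<mu>) = indicator A y * emeasure \<mu> B"
        by (simp add: nn_integral_cmult sym)
    qed
    also have "\<dots> = emeasure lborel A * emeasure lborel B"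
      by (simp add: nn_integral_multc B_def ball)
    finally have eq: "emeasure \<mu> A * emeasure lborel B = emeasure lborel A * emeasure lborel B" .
    \<comment> \<open>The volume of \<open>B\<close> has this value as its denominator; being
      positive and finite, it can be cancelled in \<open>eq\<close>.\<close>
    have "Gamma (real DIM('a) / 2 + 1) > 0"
      by (rule Gamma_real_pos) (simp add: add_nonneg_pos)
    then have "Gamma (real DIM('a) / 2 + 1) \<noteq> 0"
      by (rule less_imp_neq[symmetric])
    then have "emeasure lborel B \<noteq> 0" "emeasure lborel B \<noteq> \<infinity>"
      using emeasure_lborel_ball_finite[of "0::'a" 1]       by (auto simp: B_def emeasure_ball unit_ball_vol_def)
    then show ?thesis
      using eq by (metis ennreal_mult_cancel_left mult.commute infinity_ennreal_def)
  qed
  then have "\<mu> = lborel"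
    by (intro measure_eqI) auto
  then show ?thesis by (simp add: \<mu>_def)
qed

section \<open>Gaussian vectors: product form, rotation invariance, Laplace transform\<close>

definition std_gaussian :: "'a::euclidean_space measure" where
  "std_gaussian = density lborel (\<lambda>z. \<Prod>b\<in>Basis. ennreal (std_normal_density (z \<bullet> b)))"

lemma sets_std_gaussian [measurable_cong, simp]: "sets std_gaussian = sets borel"
  by (simp add: std_gaussian_def)

lemma space_std_gaussian [simp]: "space std_gaussian = UNIV"
  by (simp add: std_gaussian_def)

text \<open>The density depends on \<open>z\<close> only through its norm, which is the source of
  rotation invariance.\<close>

lemma prod_std_normal_density:
  fixes z :: "'a::euclidean_space"
  shows "(\<Prod>b\<in>Basis. std_normal_density (z \<bullet> b)) = (1 / sqrt (2 * pi)) ^ DIM('a) * exp (- (norm z)\<^sup>2 / 2)"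
proof -
  have "(norm z)\<^sup>2 = (\<Sum>b\<in>Basis. (z \<bullet> b)\<^sup>2)"
    unfolding power2_norm_eq_inner by (subst euclidean_inner) (simp add: power2_eq_square)
  then show ?thesis
    by (simp add: std_normal_density_def prod.distrib prod_dividef exp_sum[symmetric] sum_negf sum_divide_distrib power_one_over
      flip: prod_constant)
qed

lemma nn_integral_std_gaussian_prod:
  fixes f :: "'a::euclidean_space \<Rightarrow> real \<Rightarrow> ennreal"
  assumes [measurable]: "\<And>b. b \<in> Basis \<Longrightarrow> f b \<in> borel_measurable borel"
  shows "(\<integral>\<^sup>+z. (\<Prod>b\<in>Basis. f b (z \<bullet> b)) \<partial>std_gaussian) =
         (\<Prod>b\<in>Basis. \<integral>\<^sup>+x. ennreal (std_normal_density x) * f b x \<partial>lborel)"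
  unfolding std_gaussian_def
  by (subst nn_integral_density) (auto simp flip: prod.distrib intro!: nn_integral_lborel_prod)

text \<open>An isometry preserves Lebesgue measure and, the density being a function of the norm,
  also the density.\<close>

lemma nn_integral_std_gaussian_isometry:
  fixes f :: "'a::euclidean_space \<Rightarrow> 'a" and h :: "'a \<Rightarrow> ennreal"
  assumes f: "orthogonal_transformation f" and [measurable]: "h \<in> borel_measurable borel"
  shows "(\<integral>\<^sup>+z. h (f z) \<partial>std_gaussian) = (\<integral>\<^sup>+z. h z \<partial>std_gaussian)"
proof -
  have lin: "linear f"
    using f by (simp add: orthogonal_transformation_def)
  have [measurable]: "f \<in> borel_measurable borel"
    using lin by (intro borel_measurable_continuous_onI linear_continuous_on linear_conv_bounded_linear[THEN iffD1])
  have dens: "(\<Prod>b\<in>Basis. ennreal (std_normal_density (f z \<bullet> b))) = (\<Prod>b\<in>Basis. ennreal (std_normal_density (z \<bullet> b)))" for z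
    using f by (simp add: prod_ennreal prod_std_normal_density orthogonal_transformation)
  have "(\<integral>\<^sup>+z. h z \<partial>std_gaussian) =
        (\<integral>\<^sup>+z. (\<Prod>b\<in>Basis. ennreal (std_normal_density (z \<bullet> b))) * h z \<partial>distr lborel borel f)"
    by (simp add: std_gaussian_def nn_integral_density lborel_distr_isometry[OF f])
  also have "\<dots> = (\<integral>\<^sup>+z. h (f z) \<partial>std_gaussian)"
    by (simp add: std_gaussian_def nn_integral_density nn_integral_distr dens)
  finally show ?thesis by simp
qed

text \<open>This is the Laplace transform of a chi-square variable with one degree of freedom. The
  integrand is \<open>\<sigma>\<close> times the centred normal density with variance
  \<open>1 / (1 + 2 * s)\<close>.\<close>

lemma nn_integral_std_normal_exp:
  assumes "s \<ge> 0"
  shows "(\<integral>\<^sup>+x. ennreal (std_normal_density x) * ennreal (exp (- s * x\<^sup>2)) \<partial>lborel) = ennreal (1 / sqrt (1 + 2 * s))"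
proof -
  define \<sigma> where "\<sigma> = 1 / sqrt (1 + 2 * s)"
  have \<sigma>: "\<sigma> > 0" using assms by (simp add: \<sigma>_def)
  have \<sigma>2: "\<sigma>\<^sup>2 = 1 / (1 + 2 * s)" using assms by (simp add: \<sigma>_def power_divide)
  have "std_normal_density x * exp (- s * x\<^sup>2) = \<sigma> * normal_density 0 \<sigma> x" for x
  proof -
    have "- (x\<^sup>2) / 2 + - s * x\<^sup>2 = - (x\<^sup>2) / (2 * \<sigma>\<^sup>2)"
      using assms by (simp add: \<sigma>2 field_simps)
    moreover have "\<sigma> / sqrt (2 * pi * \<sigma>\<^sup>2) = 1 / sqrt (2 * pi)"
      using \<sigma> by (simp add: real_sqrt_mult)
    moreover have "\<sigma> * normal_density 0 \<sigma> x = \<sigma> / sqrt (2 * pi * \<sigma>\<^sup>2) * exp (- (x\<^sup>2) / (2 * \<sigma>\<^sup>2))"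
      by (simp add: normal_density_def)
    ultimately have "\<sigma> * normal_density 0 \<sigma> x = 1 / sqrt (2 * pi) * exp (- (x\<^sup>2) / 2 + - s * x\<^sup>2)"
      by (simp only:)
    then show ?thesis
      by (simp add: std_normal_density_def flip: exp_add)
  qed
  then have "(\<integral>\<^sup>+x. ennreal (std_normal_density x) * ennreal (exp (- s * x\<^sup>2)) \<partial>lborel) =
      (\<integral>\<^sup>+x. ennreal \<sigma> * ennreal (normal_density 0 \<sigma> x) \<partial>lborel)"
    using \<sigma> by (simp flip: ennreal_mult)
  also have "\<dots> = ennreal \<sigma> * (\<integral>\<^sup>+x. ennreal (normal_density 0 \<sigma> x) \<partial>lborel)"
    by (simp add: nn_integral_cmult)
  also have "(\<integral>\<^sup>+x. ennreal (normal_density 0 \<sigma> x) \<partial>lborel) = 1"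
    using prob_space.emeasure_space_1[OF prob_space_normal_density[OF \<sigma>, of 0]]
    by (simp add: emeasure_density)
  finally show ?thesis by (simp add: \<sigma>_def)
qed

lemma prob_space_std_gaussian: "prob_space (std_gaussian :: 'a::euclidean_space measure)"
proof
  have "emeasure (std_gaussian :: 'a measure) (space std_gaussian) =
      (\<integral>\<^sup>+z. (\<Prod>b\<in>Basis. (\<lambda>_. 1) (z \<bullet> b)) \<partial>(std_gaussian :: 'a measure))"
    by simp
  also have "\<dots> = 1"
    \<comment> \<open>At \<open>s = 0\<close> the Laplace transform is the total mass of one
      coordinate.\<close>
    using nn_integral_std_normal_exp[of 0] by (subst nn_integral_std_gaussian_prod) auto
  finally show "emeasure (std_gaussian :: 'a measure) (space std_gaussian) = 1" .
qed

section \<open>Inverse moments of the distance to a subspace\<close>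

text \<open>Orthonormal bases of \<open>V\<close> and of its complement \<open>W\<close> together
  have \<open>DIM('a)\<close> elements, and the one of \<open>W\<close> has at least
  \<open>card S\<close>. Match \<open>Basis\<close> injectively with their union so that
  \<open>S\<close> lands in \<open>W\<close>, then extend linearly.\<close>

lemma ex_orthogonal_transformation_into_complement:
  fixes V :: "'a::euclidean_space set"
  assumes V: "subspace V" and S: "S \<subseteq> Basis" and dim: "dim V + card S \<le> DIM('a)"
  obtains f :: "'a \<Rightarrow> 'a" where "orthogonal_transformation f"
    "\<And>b v. b \<in> S \<Longrightarrow> v \<in> V \<Longrightarrow> v \<bullet> f b = 0"
proof -
  define W where "W = {y. \<forall>x\<in>V. orthogonal x y}"
  have dimW: "dim W + dim V = DIM('a)"
    using dim_subspace_orthogonal_to_vectors[OF V subspace_UNIV] by (simp add: W_def)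
  have W: "subspace W"
    unfolding W_def by (rule subspace_orthogonal_to_vectors)
  obtain B where B: "B \<subseteq> V" "pairwise orthogonal B" "\<And>x. x \<in> B \<Longrightarrow> norm x = 1" "independent B" "card B = dim V"
    by (metis orthonormal_basis_subspace[OF V])
  obtain C where C: "C \<subseteq> W" "pairwise orthogonal C" "\<And>x. x \<in> C \<Longrightarrow> norm x = 1" "independent C" "card C = dim W"
    by (metis orthonormal_basis_subspace[OF W])
  have fin: "finite B" "finite C" "finite S"
    using B C S by (auto simp: independent_imp_finite finite_subset)
  have BC: "orthogonal x y" if "x \<in> B" "y \<in> C" for x y
    using that B(1) C(1) by (auto simp: W_def)
  then have "B \<inter> C = {}"
    using B(3) by (force simp: orthogonal_def)
  then have card_BC: "card (B \<union> C) = DIM('a)"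
    using fin B C dimW by (simp add: card_Un_disjoint)
  have orth: "pairwise orthogonal (B \<union> C)"
    using B(2) C(2) BC BC[THEN orthogonal_commute[THEN iffD1]] by (auto simp: pairwise_def)
  have "card S \<le> card C"
    using C dim dimW by simp
  then obtain g where g: "g ` S \<subseteq> C" "inj_on g S"
    using card_le_inj fin by blast
  have "card (Basis - S) \<le> card (B \<union> C - g ` S)"
    using fin S g card_BC by (subst (1 2) card_Diff_subset) (auto simp: card_image)
  then obtain h where h: "h ` (Basis - S) \<subseteq> B \<union> C - g ` S" "inj_on h (Basis - S)"
    using card_le_inj[of "Basis - S" "B \<union> C - g ` S"] fin by auto
  define \<phi> where "\<phi> b = (if b \<in> S then g b else h b)" for b
  have \<phi>: "\<phi> b \<in> B \<union> C" if "b \<in> Basis" for b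
    using that g(1) h(1) by (auto simp: \<phi>_def)
  have "inj_on \<phi> Basis"
    unfolding inj_on_def
  proof (intro ballI impI)
    fix b c assume "b \<in> Basis" "c \<in> Basis" "\<phi> b = \<phi> c"
    then show "b = c"
      using g h(1) inj_onD[OF g(2), of b c] inj_onD[OF h(2), of b c]
      by (cases "b \<in> S"; cases "c \<in> S") (auto simp: \<phi>_def)
  qed
  then have orth\<phi>: "pairwise (\<lambda>b c. orthogonal (\<phi> b) (\<phi> c)) Basis"
    unfolding pairwise_def by (metis \<phi> inj_onD orth pairwiseD)
  have norm\<phi>: "norm (\<phi> b) = 1" if "b \<in> Basis" for b
    using \<phi>[OF that] B(3) C(3) by auto
  define f where "f x = (\<Sum>b\<in>Basis. (x \<bullet> b) *\<^sub>R \<phi> b)" for x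
  have "linear f"
    unfolding f_def by (intro linear_compose_sum ballI linearI) (auto simp: algebra_simps)
  moreover have "norm (f x) = norm x" for x
  proof -
    have "(norm (f x))\<^sup>2 = (\<Sum>b\<in>Basis. (norm ((x \<bullet> b) *\<^sub>R \<phi> b))\<^sup>2)"
      unfolding f_def using orth\<phi>
      by (intro norm_sum_Pythagorean) (auto simp: pairwise_def orthogonal_clauses)
    also have "\<dots> = (norm x)\<^sup>2"
      unfolding power2_norm_eq_inner[of x] by (subst euclidean_inner) (simp add: norm\<phi> power2_eq_square)
    finally show ?thesis by simp
  qed
  ultimately have "orthogonal_transformation f"
    by (simp add: orthogonal_transformation)
  moreover have "v \<bullet> f b = 0" if "b \<in> S" "v \<in> V" for b v
  proof -
    have "f b = \<phi> b"
      using that S by (auto simp: f_def inner_Basis if_distrib[of "\<lambda>r. r *\<^sub>R _"] sum.delta cong: if_cong)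
    then show ?thesis
      using that g(1) C(1) by (auto simp: \<phi>_def W_def orthogonal_def)
  qed
  ultimately show ?thesis using that by blast
qed

text \<open>Pull a point \<open>v\<close> of \<open>V\<close> back to \<open>u\<close> with
  \<open>v = f u\<close>. The \<open>S\<close>-coordinates of \<open>u\<close> vanish, so those of
  \<open>z\<close> survive in \<open>z - u\<close>, whose norm is the distance of \<open>f z\<close>
  to \<open>v\<close>.\<close>

lemma infdist_orthogonal_transformation_ge:
  fixes V :: "'a::euclidean_space set" and f :: "'a \<Rightarrow> 'a"
  assumes f: "orthogonal_transformation f" and V: "V \<noteq> {}" and S: "S \<subseteq> Basis"
    and orth: "\<And>b v. b \<in> S \<Longrightarrow> v \<in> V \<Longrightarrow> v \<bullet> f b = 0"
  shows "(\<Sum>b\<in>S. (z \<bullet> b)\<^sup>2) \<le> (infdist (f z) V)\<^sup>2"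
proof -
  have "sqrt (\<Sum>b\<in>S. (z \<bullet> b)\<^sup>2) \<le> dist (f z) v" if "v \<in> V" for v
  proof -
    obtain u where u: "v = f u"
      using orthogonal_transformation_surj[OF f] by (auto simp: surj_def)
    have "u \<bullet> b = 0" if "b \<in> S" for b
      using orth[OF that \<open>v \<in> V\<close>] f by (simp add: u orthogonal_transformation_def)
    then have "(\<Sum>b\<in>S. (z \<bullet> b)\<^sup>2) = (\<Sum>b\<in>S. ((z - u) \<bullet> b)\<^sup>2)"
      by (simp add: inner_diff_left)
    also have "\<dots> \<le> (\<Sum>b\<in>Basis. ((z - u) \<bullet> b)\<^sup>2)"
      using S by (intro sum_mono2) auto
    also have "\<dots> = (norm (z - u))\<^sup>2"
      unfolding power2_norm_eq_inner by (subst (2) euclidean_inner) (simp add: power2_eq_square)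
    also have "norm (z - u) = dist (f z) v"
      using f by (simp add: u orthogonal_transformation_isometry dist_norm[symmetric])
    finally show ?thesis
      by (simp add: real_le_lsqrt)
  qed
  then have "sqrt (\<Sum>b\<in>S. (z \<bullet> b)\<^sup>2) \<le> infdist (f z) V"
    using V by (simp add: infdist_def cINF_greatest)
  then show ?thesis
    by (simp add: sqrt_le_D)
qed

section \<open>Laplace transforms and inverse chi-square moments\<close>

text \<open>The Laplace representation of \<open>1 / x ^ Suc p\<close>; unlike the latter it is infinite at \<open>0\<close>.\<close>

definition laplace_power :: "nat \<Rightarrow> real \<Rightarrow> ennreal" where
  "laplace_power p x = (\<integral>\<^sup>+s. ennreal (s ^ p / fact p * exp (- s * x)) * indicator {0..} s \<partial>lborel)"

lemma laplace_power_measurable [measurable]: "laplace_power p \<in> borel_measurable borel"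
  unfolding laplace_power_def by measurable

lemma laplace_power_antimono: "x \<le> y \<Longrightarrow> laplace_power p y \<le> laplace_power p x"
  unfolding laplace_power_def
  by (intro nn_integral_mono) (auto simp: indicator_def intro!: ennreal_leI divide_right_mono mult_left_mono)

text \<open>Up to the factor \<open>1 / x ^ Suc p\<close> the integrand is the Erlang density of
  rate \<open>x\<close>, which has mass one.\<close>

lemma laplace_power_pos:
  assumes "x > 0"
  shows "laplace_power p x = ennreal (1 / x ^ Suc p)"
proof -
  have "ennreal (s ^ p / fact p * exp (- s * x)) * indicator {0..} s = ennreal (1 / x ^ Suc p) * ennreal (erlang_density p x s)" for s
    using assms by (auto simp: erlang_density_def indicator_def mult.commute simp flip: ennreal_mult)
  then have "laplace_power p x = ennreal (1 / x ^ Suc p) * (\<integral>\<^sup>+s. ennreal (erlang_density p x s) \<partial>lborel)"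
    by (simp add: laplace_power_def nn_integral_cmult)
  also have "(\<integral>\<^sup>+s. ennreal (erlang_density p x s) \<partial>lborel) = 1"
    using prob_space.emeasure_space_1[OF prob_space_erlang_density[OF assms, of p]]
    by (simp add: emeasure_density)
  finally show ?thesis by simp
qed

text \<open>By antitonicity the value at \<open>0\<close> is at least \<open>1 / x ^ Suc p\<close>
  for every positive \<open>x\<close>; the choice \<open>x = 1 / (r + 1)\<close> exceeds any
  proposed finite value \<open>r\<close>.\<close>

lemma laplace_power_zero: "laplace_power p 0 = \<infinity>"
proof (rule ccontr)
  assume "laplace_power p 0 \<noteq> \<infinity>"
  then obtain r where r: "r \<ge> 0" "laplace_power p 0 = ennreal r"
    by (cases "laplace_power p 0") auto
  define x where "x = 1 / (r + 1)"
  have x: "x > 0" using r by (simp add: x_def)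
  have "ennreal (1 / x ^ Suc p) \<le> ennreal r"
    using laplace_power_antimono[of 0 x p] x r by (simp add: laplace_power_pos)
  then have "(r + 1) ^ Suc p \<le> r"
    using r by (simp add: x_def power_one_over)
  moreover have "r + 1 \<le> (r + 1) ^ Suc p"
    using r by (intro self_le_power) auto
  ultimately show False by simp
qed

text \<open>The substitution \<open>v = 2 * s / (1 + 2 * s)\<close> maps the half-line to
  \<open>[0, 1)\<close> and turns the integrand into a constant times
  \<open>v ^ p * (1 - v)\<close>, a Beta integral. \<open>G\<close> is the resulting
  antiderivative.\<close>

lemma nn_integral_power_over_power:
  "(\<integral>\<^sup>+s. ennreal (s ^ p / fact p * (1 / (1 + 2 * s) ^ (p + 3))) * indicator {0..} s \<partial>lborel)
     = ennreal (1 / (2 ^ (p + 1) * fact (p + 2)))"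
proof -
  define v where "v s = 2 * s / (1 + 2 * s)" for s :: real
  define G where "G s = (v s ^ (p + 1) / real (p + 1) - v s ^ (p + 2) / real (p + 2)) / (2 ^ (p + 1) * fact p)" for s
  have dv: "(v has_field_derivative 2 / (1 + 2 * s)\<^sup>2) (at s)" if "s \<ge> 0" for s
    unfolding v_def using that
    by (auto intro!: derivative_eq_intros simp: power2_eq_square field_simps)
  have "(G has_field_derivative s ^ p / fact p * (1 / (1 + 2 * s) ^ (p + 3))) (at s)" if s: "s \<ge> 0" for s
  proof -
    have "(G has_field_derivative (v s ^ p - v s ^ (p + 1)) * (2 / (1 + 2 * s)\<^sup>2) / (2 ^ (p + 1) * fact p)) (at s)"
    proof -
      have d: "((\<lambda>s. v s ^ Suc k / real (Suc k)) has_field_derivative v s ^ k * (2 / (1 + 2 * s)\<^sup>2)) (at s)" for k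
        using DERIV_cdivide[OF DERIV_power[OF dv[OF s], of "Suc k"], of "real (Suc k)"]
        by (simp del: of_nat_Suc add: mult.commute)
      show ?thesis
        using DERIV_cdivide[OF DERIV_diff[OF d[of p] d[of "Suc p"]], of "2 ^ (p + 1) * fact p"]
        unfolding G_def left_diff_distrib Suc_eq_plus1 add.assoc one_add_one .
    qed
    moreover have "(v s ^ p - v s ^ (p + 1)) * (2 / (1 + 2 * s)\<^sup>2) = 2 ^ (p + 1) * (s ^ p / (1 + 2 * s) ^ (p + 3))"
    proof -
      have "v s ^ p - v s ^ (p + 1) = v s ^ p * (1 - v s)"
        by (simp add: algebra_simps)
      also have "1 - v s = 1 / (1 + 2 * s)"
        using s by (simp add: v_def field_simps)
      finally show ?thesis
        using s by (simp add: v_def power_divide power_mult_distrib power_add eval_nat_numeral ac_simps)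
    qed
    ultimately have "(G has_field_derivative 2 ^ (p + 1) * (s ^ p / (1 + 2 * s) ^ (p + 3)) / (2 ^ (p + 1) * fact p)) (at s)"
      by (simp only:)
    then show ?thesis by (simp add: mult.commute)
  qed
  moreover have "(G \<longlongrightarrow> (1 ^ (p + 1) / real (p + 1) - 1 ^ (p + 2) / real (p + 2)) / (2 ^ (p + 1) * fact p)) at_top"
  proof -
    have "(v \<longlongrightarrow> 1) at_top"
    proof (rule Lim_transform_eventually)
      have "filterlim (\<lambda>s::real. 1 + 2 * s) at_top at_top"
        by (intro filterlim_tendsto_add_at_top[OF tendsto_const] filterlim_tendsto_pos_mult_at_top[OF tendsto_const] filterlim_ident) simp
      then show "((\<lambda>s::real. 1 - inverse (1 + 2 * s)) \<longlongrightarrow> 1) at_top"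
        using tendsto_diff[OF tendsto_const tendsto_inverse_0_at_top, of _ at_top 1] by simp
      show "\<forall>\<^sub>F s in at_top. 1 - inverse (1 + 2 * s) = v s"
        using eventually_ge_at_top[of 0] by eventually_elim (simp add: v_def field_simps)
    qed
    then show ?thesis
      unfolding G_def by (intro tendsto_intros) auto
  qed
  ultimately have "(\<integral>\<^sup>+s. ennreal (s ^ p / fact p * (1 / (1 + 2 * s) ^ (p + 3))) * indicator {0..} s \<partial>lborel)
     = ennreal ((1 ^ (p + 1) / real (p + 1) - 1 ^ (p + 2) / real (p + 2)) / (2 ^ (p + 1) * fact p) - G 0)"
    by (intro nn_integral_FTC_atLeast) auto
  also have "G 0 = 0"
    by (simp add: G_def v_def)
  \<comment> \<open>The difference \<open>1 / (p + 1) - 1 / (p + 2)\<close> is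
    \<open>1 / ((p + 1) * (p + 2))\<close>, which completes \<open>fact p\<close> to
    \<open>fact (p + 2)\<close>.\<close>
  also have "(1 ^ (p + 1) / real (p + 1) - 1 ^ (p + 2) / real (p + 2)) / (2 ^ (p + 1) * fact p) = 1 / (2 ^ (p + 1) * fact (p + 2))"
    by (simp add: fact_reduce[of "p + 2"] field_simps)
  finally show ?thesis by simp
qed

text \<open>This is the inverse moment of order \<open>p + 1\<close> of a chi-square variable with
  \<open>2 * (p + 3)\<close> degrees of freedom. After exchanging the integrals, each coordinate in
  \<open>S\<close> contributes \<open>1 / sqrt (1 + 2 * s)\<close>.\<close>

lemma nn_integral_std_gaussian_laplace_power:
  fixes S :: "'a::euclidean_space set"
  assumes S: "S \<subseteq> Basis" "card S = 2 * (p + 3)"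
  shows "(\<integral>\<^sup>+z. laplace_power p (\<Sum>b\<in>S. (z \<bullet> b)\<^sup>2) \<partial>std_gaussian) = ennreal (1 / (2 ^ (p + 1) * fact (p + 2)))"
proof -
  interpret std_gaussian: prob_space "std_gaussian :: 'a measure"
    by (rule prob_space_std_gaussian)
  interpret pair_sigma_finite "std_gaussian :: 'a measure" "lborel :: real measure" ..
  have "(\<integral>\<^sup>+z. laplace_power p (\<Sum>b\<in>S. (z \<bullet> b)\<^sup>2) \<partial>std_gaussian)
    = (\<integral>\<^sup>+s. \<integral>\<^sup>+z. ennreal (s ^ p / fact p * exp (- s * (\<Sum>b\<in>S. (z \<bullet> b)\<^sup>2))) * indicator {0..} s \<partial>(std_gaussian :: 'a measure) \<partial>lborel)"
    unfolding laplace_power_def by (rule Fubini'[symmetric]) measurable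
  also have "\<dots> = (\<integral>\<^sup>+s. ennreal (s ^ p / fact p * (1 / (1 + 2 * s) ^ (p + 3))) * indicator {0..} s \<partial>lborel)"
  proof (rule nn_integral_cong)
    fix s :: real
    show "(\<integral>\<^sup>+z. ennreal (s ^ p / fact p * exp (- s * (\<Sum>b\<in>S. (z \<bullet> b)\<^sup>2))) * indicator {0..} s \<partial>(std_gaussian :: 'a measure))
      = ennreal (s ^ p / fact p * (1 / (1 + 2 * s) ^ (p + 3))) * indicator {0..} s"
    proof (cases "s \<ge> 0")
      case True
      \<comment> \<open>Coordinates outside \<open>S\<close> get the factor \<open>1\<close>, so
        that the product runs over the whole basis and the integral factorises.\<close>
      define g where "g b x = (if b \<in> S then ennreal (exp (- s * x\<^sup>2)) else 1)" for b :: 'a and x :: real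
      have [measurable]: "g b \<in> borel_measurable borel" for b
        unfolding g_def by measurable
      have "ennreal (exp (- s * (\<Sum>b\<in>S. (z \<bullet> b)\<^sup>2))) = (\<Prod>b\<in>Basis. g b (z \<bullet> b))" for z
      proof -
        have "exp (- s * (\<Sum>b\<in>S. (z \<bullet> b)\<^sup>2)) = (\<Prod>b\<in>S. exp (- s * (z \<bullet> b)\<^sup>2))"
          using finite_subset[OF S(1)] by (simp add: sum_distrib_left exp_sum)
        also have "ennreal \<dots> = (\<Prod>b\<in>S. g b (z \<bullet> b))"
          by (subst prod_ennreal[symmetric]) (simp_all add: g_def)
        also have "\<dots> = (\<Prod>b\<in>Basis. g b (z \<bullet> b))"
          using S by (intro prod.mono_neutral_left) (simp_all add: g_def)
        finally show ?thesis .
      qed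
      then have "(\<integral>\<^sup>+z. ennreal (exp (- s * (\<Sum>b\<in>S. (z \<bullet> b)\<^sup>2))) \<partial>(std_gaussian :: 'a measure)) =
         (\<Prod>b\<in>Basis. \<integral>\<^sup>+x. ennreal (std_normal_density x) * g b x \<partial>lborel)"
        by (simp add: nn_integral_std_gaussian_prod)
      also have "\<dots> = (\<Prod>b\<in>S. \<integral>\<^sup>+x. ennreal (std_normal_density x) * g b x \<partial>lborel)"
        using S nn_integral_std_normal_exp[of 0] by (intro prod.mono_neutral_right) (simp_all add: g_def)
      also have "\<dots> = (\<Prod>b\<in>S. ennreal (1 / sqrt (1 + 2 * s)))"
        using nn_integral_std_normal_exp[OF True] by (intro prod.cong) (simp_all add: g_def)
      also have "\<dots> = ennreal ((1 / sqrt (1 + 2 * s)) ^ (2 * (p + 3)))"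
        using True by (simp add: S ennreal_power)
      also have "(1 / sqrt (1 + 2 * s)) ^ (2 * (p + 3)) = 1 / (1 + 2 * s) ^ (p + 3)"
        using True by (simp add: power_mult power_divide del: mult_Suc_right distrib_left_numeral)
      finally have eq: "(\<integral>\<^sup>+z. ennreal (exp (- s * (\<Sum>b\<in>S. (z \<bullet> b)\<^sup>2))) \<partial>(std_gaussian :: 'a measure)) =
        ennreal (1 / (1 + 2 * s) ^ (p + 3))" .
      have "(\<integral>\<^sup>+z. ennreal (s ^ p / fact p * exp (- s * (\<Sum>b\<in>S. (z \<bullet> b)\<^sup>2))) \<partial>(std_gaussian :: 'a measure)) =
        (\<integral>\<^sup>+z. ennreal (s ^ p / fact p) * ennreal (exp (- s * (\<Sum>b\<in>S. (z \<bullet> b)\<^sup>2))) \<partial>(std_gaussian :: 'a measure))"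
        using True by (simp add: ennreal_mult del: times_divide_eq_left)
      also have "\<dots> = ennreal (s ^ p / fact p) * ennreal (1 / (1 + 2 * s) ^ (p + 3))"
        by (subst nn_integral_cmult) (simp_all only: eq, measurable)
      also have "\<dots> = ennreal (s ^ p / fact p * (1 / (1 + 2 * s) ^ (p + 3)))"
        using True by (intro ennreal_mult[symmetric]) auto
      finally show ?thesis
        using True by simp
    qed simp
  qed
  also have "\<dots> = ennreal (1 / (2 ^ (p + 1) * fact (p + 2)))"
    by (rule nn_integral_power_over_power)
  finally show ?thesis .
qed

text \<open>Rotate \<open>2 * (p + 3)\<close> axes into the orthogonal complement of
  \<open>V\<close>. The distance to \<open>V\<close> then dominates the norm of these coordinates,
  and \<open>laplace_power\<close> is antitone.\<close>

lemma nn_integral_std_gaussian_infdist_le: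
  fixes V :: "'a::euclidean_space set"
  assumes V: "subspace V" and dim: "dim V + 2 * (p + 3) \<le> DIM('a)"
  shows "(\<integral>\<^sup>+z. laplace_power p ((infdist z V)\<^sup>2) \<partial>std_gaussian) \<le> ennreal (1 / (2 ^ (p + 1) * fact (p + 2)))"
proof -
  obtain S :: "'a set" where S: "S \<subseteq> Basis" "card S = 2 * (p + 3)"
    using dim by (metis obtain_subset_with_card_n add_leE)
  obtain f :: "'a \<Rightarrow> 'a" where f: "orthogonal_transformation f"
    "\<And>b v. b \<in> S \<Longrightarrow> v \<in> V \<Longrightarrow> v \<bullet> f b = 0"
    using ex_orthogonal_transformation_into_complement[OF V S(1)] dim S(2) by metis
  have [measurable]: "(\<lambda>z. infdist z V) \<in> borel_measurable borel"
    by (intro borel_measurable_continuous_onI continuous_intros)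
  have "V \<noteq> {}" using subspace_0[OF V] by auto
  have "(\<integral>\<^sup>+z. laplace_power p ((infdist z V)\<^sup>2) \<partial>std_gaussian) =
        (\<integral>\<^sup>+z. laplace_power p ((infdist (f z) V)\<^sup>2) \<partial>std_gaussian)"
    by (subst nn_integral_std_gaussian_isometry[OF f(1)]) measurable
  also have "\<dots> \<le> (\<integral>\<^sup>+z. laplace_power p (\<Sum>b\<in>S. (z \<bullet> b)\<^sup>2) \<partial>std_gaussian)"
    by (intro nn_integral_mono laplace_power_antimono infdist_orthogonal_transformation_ge f S \<open>V \<noteq> {}\<close>)
  also have "\<dots> = ennreal (1 / (2 ^ (p + 1) * fact (p + 2)))"
    by (rule nn_integral_std_gaussian_laplace_power[OF S])
  finally show ?thesis .
qed

section \<open>Row distances and the pseudoinverse\<close>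

instantiation quat :: euclidean_space
begin

definition Basis_quat :: "quat set" where "Basis_quat = {1, iq, jq, kq}"

instance
proof
  show "(Basis :: quat set) \<noteq> {}" "finite (Basis :: quat set)"
    by (simp_all add: Basis_quat_def)
  show "u \<bullet> v = (if u = v then 1 else 0)" if "u \<in> Basis" "v \<in> Basis" for u v :: quat
    using that by (auto simp: Basis_quat_def inner_quat_def quat_eq_iff iq_def jq_def kq_def)
  show "(\<forall>u\<in>Basis. x \<bullet> u = 0) \<longleftrightarrow> x = 0" for x :: quat
    by (simp add: Basis_quat_def inner_quat_def iq_def jq_def kq_def) (auto simp: quat_eq_iff)
qed

end

lemma DIM_quat [simp]: "DIM(quat) = 4"
  by (simp add: Basis_quat_def quat_eq_iff iq_def jq_def kq_def)

lemma inner_quat_eq_qre: "p \<bullet> q = qre (p * qcnj q)"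
  by (simp add: inner_quat_def times_quat_sel)

lemma qre_sum: "qre (sum f A) = (\<Sum>x\<in>A. qre (f x))"
  by (induction A rule: infinite_finite_induct) simp_all

lemma mult_qcnj: "q * qcnj q = (norm q)\<^sup>2 *\<^sub>R 1"
  by (simp add: quat_eq_iff times_quat_sel norm_quat_def) (simp add: power2_eq_square)

lemma norm_qcnj [simp]: "norm (qcnj q) = norm q"
  by (simp add: norm_quat_def)

lemma qcnj_diff: "qcnj (p - q) = qcnj p - qcnj q"
  by (simp add: quat_eq_iff)

lemma hermitian_hermitian [simp]: "hermitian (hermitian A) = A"
  by (simp add: hermitian_def vec_eq_iff)

lemma hermitian_mat_1 [simp]: "hermitian (mat 1) = mat 1"
  by (auto simp: hermitian_def mat_def vec_eq_iff quat_eq_iff)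

lemma norm_vec_power2: "(norm (x :: 'a::real_normed_vector^'n))\<^sup>2 = (\<Sum>j\<in>UNIV. (norm (x $ j))\<^sup>2)"
  by (simp add: norm_vec_def L2_set_def sum_nonneg)

text \<open>Left-linear in the first argument, with the Euclidean inner product as its real part.
  Its values on rows are the entries of a product with a \<open>hermitian\<close> matrix.\<close>

definition qinner :: "quat^'n \<Rightarrow> quat^'n \<Rightarrow> quat" where
  "qinner x y = (\<Sum>j\<in>UNIV. x $ j * qcnj (y $ j))"

lemma qinner_self: "qinner x x = (norm x)\<^sup>2 *\<^sub>R 1"
  by (simp add: qinner_def mult_qcnj norm_vec_power2 scaleR_sum_left)

lemma qinner_diff_right: "qinner x (y - z) = qinner x y - qinner x z"
  by (simp add: qinner_def qcnj_diff right_diff_distrib sum_subtractf)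

lemma qinner_scaleR_left: "qinner (r *\<^sub>R x) y = r *\<^sub>R qinner x y"
  by (simp add: qinner_def scaleR_sum_right)

text \<open>The library's \<open>v*\<close> would multiply by the scalars on the right.\<close>

definition row_comb :: "quat^'n^'m \<Rightarrow> quat^'m \<Rightarrow> quat^'n" where
  "row_comb A c = (\<chi> j. \<Sum>l\<in>UNIV. c $ l * A $ l $ j)"

lemma linear_row_comb: "linear (row_comb A)"
  by (rule linearI) (simp_all add: row_comb_def vec_eq_iff algebra_simps sum.distrib scaleR_sum_right)

lemma row_comb_axis: "row_comb A (axis l u) = (\<chi> j. u * A $ l $ j)"
  by (auto simp: row_comb_def vec_eq_iff axis_def if_distrib[of "\<lambda>x. x * _"] cong: if_cong)

lemma qinner_row_comb_right: "qinner x (row_comb A c) = (\<Sum>l\<in>UNIV. qinner x (A $ l) * qcnj (c $ l))"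
  unfolding qinner_def row_comb_def
  by (simp add: qcnj_sum qcnj_mult sum_distrib_left sum_distrib_right mult.assoc)
    (rule sum.swap)

text \<open>Links real and quaternionic orthogonality: being real-orthogonal to all left multiples
  of a row forces the \<open>qinner\<close> with that row to vanish.\<close>

lemma inner_row_comb_axis: "x \<bullet> row_comb A (axis l u) = qinner x (A $ l) \<bullet> u"
  by (simp add: row_comb_axis inner_vec_def inner_quat_eq_qre qinner_def qcnj_mult sum_distrib_right qre_sum
      mult.assoc)

section \<open>Distance of a row to the left span of the other rows\<close>

definition other_rows_span :: "quat^'n^'m \<Rightarrow> 'm \<Rightarrow> (quat^'n) set" where
  "other_rows_span A i = row_comb A ` {c. c $ i = 0}"

lemma subspace_other_rows_span: "subspace (other_rows_span A i)"
  unfolding other_rows_span_def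
  by (intro linear_subspace_image linear_row_comb) (simp add: subspace_def)

text \<open>For the conditioning on the other rows: their span stays fixed while row
  \<open>i\<close> varies.\<close>

lemma other_rows_span_cong:
  assumes "\<And>l. l \<noteq> i \<Longrightarrow> A $ l = B $ l"
  shows "other_rows_span A i = other_rows_span B i"
proof -
  have "row_comb A c = row_comb B c" if "c $ i = 0" for c
    using that assms by (auto simp: row_comb_def vec_eq_iff intro!: sum.cong) (metis mult_zero_left)
  then show ?thesis
    by (auto simp: other_rows_span_def image_def)
qed

text \<open>The span is a real-linear image of the coefficient vectors vanishing at
  \<open>i\<close>, which are spanned by the basis vectors outside the four axes of coordinate
  \<open>i\<close>.\<close>

lemma dim_other_rows_span_le:
  fixes A :: "quat^'n^'m"
  shows "dim (other_rows_span A i) \<le> 4 * (CARD('m) - 1)"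
proof -
  let ?B = "Basis - (axis i ` Basis) :: (quat^'m) set"
  have "{c :: quat^'m. c $ i = 0} \<subseteq> span ?B"
  proof
    fix c :: "quat^'m" assume "c \<in> {c. c $ i = 0}"
    then have "(c \<bullet> b) *\<^sub>R b = 0" if "b \<in> axis i ` Basis" for b
      using that by (auto simp: inner_axis)
    then have "(\<Sum>b\<in>?B. (c \<bullet> b) *\<^sub>R b) = (\<Sum>b\<in>Basis. (c \<bullet> b) *\<^sub>R b)"
      by (intro sum.mono_neutral_left) auto
    then have "c = (\<Sum>b\<in>?B. (c \<bullet> b) *\<^sub>R b)"
      by (simp add: euclidean_representation)
    also have "\<dots> \<in> span ?B"
      by (intro span_sum span_scale span_base)
    finally show "c \<in> span ?B" .
  qed
  then have "dim {c :: quat^'m. c $ i = 0} \<le> card ?B"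
    by (intro dim_le_card) auto
  also have "axis i ` Basis \<subseteq> (Basis :: (quat^'m) set)"
    by (auto simp: Basis_vec_def)
  then have "card ?B = 4 * CARD('m) - 4"
    by (simp add: card_Diff_subset card_image inj_on_def axis_eq_axis)
  finally have "dim {c :: quat^'m. c $ i = 0} \<le> 4 * (CARD('m) - 1)"
    by (simp add: diff_mult_distrib2)
  then show ?thesis
    unfolding other_rows_span_def
    using dim_image_le[OF linear_row_comb, of A "{c. c $ i = 0}"] by simp
qed

definition row_dist :: "quat^'n^'m \<Rightarrow> 'm \<Rightarrow> real" where
  "row_dist A i = infdist (A $ i) (other_rows_span A i)"

lemma row_dist_nonneg: "row_dist A i \<ge> 0"
  by (simp add: row_dist_def infdist_nonneg)

text \<open>Replaces the infimum over a set that depends on \<open>A\<close> by a union over fixed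
  coefficients \<open>c\<close>, each giving an open condition on \<open>A\<close>.\<close>

lemma row_dist_less_iff: "row_dist A i < a \<longleftrightarrow> (\<exists>c. c $ i = 0 \<and> dist (A $ i) (row_comb A c) < a)"
proof -
  have "other_rows_span A i \<noteq> {}"
    using subspace_0[OF subspace_other_rows_span] by auto
  then have "row_dist A i < a \<longleftrightarrow> (\<exists>v\<in>other_rows_span A i. dist (A $ i) v < a)"
    by (simp add: row_dist_def infdist_def cINF_less_iff)
  then show ?thesis
    by (auto simp: other_rows_span_def)
qed

text \<open>Row distances are discontinuous where the rank drops, but upper semicontinuous.\<close>

lemma row_dist_measurable [measurable]:
  "(\<lambda>A :: quat^'n^'m. row_dist A i) \<in> borel_measurable borel"
proof (rule borel_measurableI_less)
  fix a
  have "open (\<Union>c\<in>{c. c $ i = 0}. {A :: quat^'n^'m. dist (A $ i) (row_comb A c) < a})"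
    unfolding row_comb_def
    by (intro open_UN ballI open_Collect_less continuous_intros)
  also have "(\<Union>c\<in>{c. c $ i = 0}. {A :: quat^'n^'m. dist (A $ i) (row_comb A c) < a}) = {A. row_dist A i < a}"
    by (auto simp: row_dist_less_iff)
  finally show "{A \<in> space borel. row_dist A i < a} \<in> sets (borel :: (quat^'n^'m) measure)"
    by simp
qed

section \<open>The pseudoinverse of a matrix with positive row distances\<close>

lemma pseudoinverse_eqI: "is_pseudoinverse A X \<Longrightarrow> pseudoinverse A = X"
  unfolding pseudoinverse_def by (rule the_equality) (auto intro: is_pseudoinverse_unique)

text \<open>Conjugating the assumption shows that \<open>hermitian C\<close> is a right inverse of
  the Gram matrix \<open>A ** hermitian A\<close>, of which \<open>C\<close> is a left inverse. The
  two therefore agree, and all four Penrose conditions follow.\<close>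

lemma is_pseudoinverse_right_inverse:
  fixes A :: "quat^'n^'m" and C :: "quat^'m^'m"
  assumes "C ** A ** hermitian A = mat 1"
  shows "is_pseudoinverse A (hermitian (C ** A))"
proof -
  have r: "A ** hermitian A ** hermitian C = mat 1"
    using arg_cong[OF assms, of hermitian] by (simp add: hermitian_mult matrix_mul_assoc)
  then have AX: "A ** hermitian (C ** A) = mat 1"
    by (simp add: hermitian_mult matrix_mul_assoc)
  have "C = C ** (A ** hermitian A ** hermitian C)"
    by (simp add: r)
  also have "\<dots> = (C ** A ** hermitian A) ** hermitian C"
    by (simp add: matrix_mul_assoc)
  finally have "hermitian C = C"
    by (simp add: assms)
  then have "hermitian (hermitian (C ** A) ** A) = hermitian (C ** A) ** A"
    by (simp add: hermitian_mult matrix_mul_assoc)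
  moreover have "hermitian (C ** A) ** A ** hermitian (C ** A) = hermitian (C ** A)"
    by (simp only: matrix_mul_assoc[symmetric] AX matrix_mul_rid)
  ultimately show ?thesis
    by (simp add: is_pseudoinverse_def AX)
qed

text \<open>Let \<open>w i\<close> be the part of row \<open>i\<close> orthogonal to the other rows.
  The vectors \<open>w i\<close> divided by their squared norms are dual to the rows of
  \<open>A\<close>, and their conjugate transpose is the pseudoinverse.\<close>

lemma frobenius_norm_pseudoinverse_le:
  fixes A :: "quat^'n^'m"
  assumes pos: "\<And>i. row_dist A i > 0"
  shows "(frobenius_norm (pseudoinverse A))\<^sup>2 \<le> (\<Sum>i\<in>UNIV. 1 / (row_dist A i)\<^sup>2)"
proof -
  have "\<exists>c. c $ i = 0 \<and> (\<forall>v\<in>other_rows_span A i. (A $ i - row_comb A c) \<bullet> v = 0)" for i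
  proof -
    obtain y z where yz: "y \<in> span (other_rows_span A i)" "\<And>w. w \<in> span (other_rows_span A i) \<Longrightarrow> orthogonal z w"
      "A $ i = y + z"
      using orthogonal_subspace_decomp_exists by metis
    have "y \<in> other_rows_span A i"
      using yz(1) subspace_other_rows_span by (metis span_eq_iff)
    then obtain c where c: "y = row_comb A c" "c $ i = 0"
      by (auto simp: other_rows_span_def)
    have "(A $ i - row_comb A c) \<bullet> v = 0" if "v \<in> other_rows_span A i" for v
      using yz(2)[OF span_base[OF that]] by (simp add: orthogonal_def yz(3) c(1))
    with c(2) show ?thesis by blast
  qed
  then obtain c where c: "\<And>i. c i $ i = 0"
    and orth: "\<And>i v. v \<in> other_rows_span A i \<Longrightarrow> (A $ i - row_comb A (c i)) \<bullet> v = 0"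
    by metis
  define w where "w i = A $ i - row_comb A (c i)" for i
  have norm_w: "row_dist A i \<le> norm (w i)" for i
    unfolding row_dist_def w_def dist_norm[symmetric]
    by (rule infdist_le) (use c in \<open>auto simp: other_rows_span_def\<close>)
  have w_pos: "norm (w i) > 0" for i
    using norm_w[of i] pos[of i] by linarith
  have q_other: "qinner (w i) (A $ l) = 0" if "l \<noteq> i" for i l
  proof -
    \<comment> \<open>Real orthogonality is applied to the left multiple of row \<open>l\<close> by
      \<open>?h\<close> itself, which gives \<open>?h \<bullet> ?h = 0\<close>.\<close>
    let ?h = "qinner (w i) (A $ l)"
    have "row_comb A (axis l ?h) \<in> other_rows_span A i"
      using that by (auto simp: other_rows_span_def axis_def)
    then have "?h \<bullet> ?h = 0"
      using orth[of _ i] by (simp add: w_def flip: inner_row_comb_axis)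
    then show ?thesis by simp
  qed
  have "qinner (w i) (row_comb A (c i)) = 0" for i
    unfolding qinner_row_comb_right using q_other[of _ i] c[of i]
    by (intro sum.neutral ballI) (metis mult_zero_left mult_zero_right qcnj_0)
  then have q_self: "qinner (w i) (A $ i) = (norm (w i))\<^sup>2 *\<^sub>R 1" for i
    using qinner_self[of "w i"] by (simp add: w_def qinner_diff_right)
  \<comment> \<open>Row \<open>i\<close> of \<open>C\<close> holds the coefficients that express the
    dual vector by the rows of \<open>A\<close>.\<close>
  define C :: "quat^'m^'m" where "C = (\<chi> i l. (1 / (norm (w i))\<^sup>2) *\<^sub>R ((if l = i then 1 else 0) - c i $ l))"
  have CA: "(C ** A) $ i = (1 / (norm (w i))\<^sup>2) *\<^sub>R w i" for i
    by (simp add: C_def matrix_matrix_mult_def vec_eq_iff w_def row_comb_def left_diff_distrib sum_subtractf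
        scaleR_sum_right[symmetric] if_distrib[of "\<lambda>x. x * _"] cong: if_cong)
  have "(C ** A ** hermitian A) $ i $ l = mat 1 $ i $ l" for i l
  proof -
    have "(C ** A ** hermitian A) $ i $ l = qinner ((C ** A) $ i) (A $ l)"
      by (simp add: matrix_matrix_mult_def[of "C ** A"] hermitian_def qinner_def)
    also have "\<dots> = (1 / (norm (w i))\<^sup>2) *\<^sub>R qinner (w i) (A $ l)"
      by (simp add: CA qinner_scaleR_left)
    also have "\<dots> = mat 1 $ i $ l"
      using q_other[of l i] q_self[of i] w_pos[of i] by (auto simp: mat_def)
    finally show ?thesis .
  qed
  then have "is_pseudoinverse A (hermitian (C ** A))"
    by (intro is_pseudoinverse_right_inverse) (simp add: vec_eq_iff)
  then have "pseudoinverse A = hermitian (C ** A)"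
    by (rule pseudoinverse_eqI)
  then have "(frobenius_norm (pseudoinverse A))\<^sup>2 = (\<Sum>j\<in>UNIV. \<Sum>i\<in>UNIV. (norm ((C ** A) $ i $ j))\<^sup>2)"
    by (simp add: frobenius_norm_def sum_nonneg hermitian_def)
  also have "\<dots> = (\<Sum>i\<in>UNIV. (norm ((C ** A) $ i))\<^sup>2)"
    by (subst sum.swap) (simp add: norm_vec_power2)
  also have "\<dots> = (\<Sum>i\<in>UNIV. 1 / (norm (w i))\<^sup>2)"
    using w_pos by (intro sum.cong) (auto simp: CA power2_eq_square)
  also have "\<dots> \<le> (\<Sum>i\<in>UNIV. 1 / (row_dist A i)\<^sup>2)"
    using norm_w pos by (intro sum_mono divide_left_mono power_mono) (auto intro!: less_imp_le zero_less_power mult_pos_pos w_pos)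
  finally show ?thesis .
qed

section \<open>Gaussian quaternion matrices\<close>

definition std_normal :: "real measure" where
  "std_normal = density lborel (\<lambda>x. ennreal (std_normal_density x))"

lemma sets_std_normal [measurable_cong, simp]: "sets std_normal = sets borel"
  by (simp add: std_normal_def)

lemma space_std_normal [simp]: "space std_normal = UNIV"
  by (simp add: std_normal_def)

lemma prob_space_std_normal: "prob_space std_normal"
  unfolding std_normal_def by (rule prob_space_normal_density) simp

text \<open>Both measures agree on boxes, where the Gaussian integral factorises over the
  coordinates.\<close>

lemma PiM_std_normal_eq_distr_std_gaussian:
  fixes e :: "'k \<Rightarrow> 'a::euclidean_space"
  assumes e: "bij_betw e K Basis"
  shows "PiM K (\<lambda>_. std_normal) = distr std_gaussian (PiM K (\<lambda>_. borel)) (\<lambda>z. \<lambda>k\<in>K. z \<bullet> e k)"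
proof -
  interpret product_sigma_finite "\<lambda>_ :: 'k. std_normal"
    by (intro product_sigma_finite.intro prob_space_imp_sigma_finite prob_space_std_normal)
  have fin: "finite K"
    using bij_betw_finite[OF e] by simp
  have "distr std_gaussian (PiM K (\<lambda>_. borel)) (\<lambda>z. \<lambda>k\<in>K. z \<bullet> e k) = PiM K (\<lambda>_. std_normal)"
  proof (rule PiM_eqI[OF fin])
    show "sets (distr std_gaussian (PiM K (\<lambda>_. borel)) (\<lambda>z. \<lambda>k\<in>K. z \<bullet> e k)) = sets (PiM K (\<lambda>_. std_normal))"
      by (simp cong: sets_PiM_cong)
    fix A :: "'k \<Rightarrow> real set"
    assume A: "\<And>k. k \<in> K \<Longrightarrow> A k \<in> sets std_normal"
    define A' where "A' b = A (inv_into K e b)" for b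
    have A'e: "A' (e k) = A k" if "k \<in> K" for k
      using that e by (simp add: A'_def bij_betw_inv_into_left)
    have A' [measurable]: "A' b \<in> sets borel" if "b \<in> Basis" for b
      using A that bij_betw_inv_into[OF e] by (auto simp: A'_def bij_betw_def)
    have "emeasure (distr std_gaussian (PiM K (\<lambda>_. borel)) (\<lambda>z. \<lambda>k\<in>K. z \<bullet> e k)) (Pi\<^sub>E K A) =
        emeasure std_gaussian ((\<lambda>z. \<lambda>k\<in>K. z \<bullet> e k) -` Pi\<^sub>E K A \<inter> space std_gaussian)"
      using A fin by (intro emeasure_distr sets_PiM_I_finite) (auto intro!: measurable_restrict)
    also have "\<dots> = (\<integral>\<^sup>+z. indicator ((\<lambda>z. \<lambda>k\<in>K. z \<bullet> e k) -` Pi\<^sub>E K A \<inter> space std_gaussian) z \<partial>std_gaussian)"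
      using A fin
      by (intro nn_integral_indicator[symmetric] measurable_sets[where A = "PiM K (\<lambda>_. borel)"] sets_PiM_I_finite)
        (auto intro!: measurable_restrict)
    also have "\<dots> = (\<integral>\<^sup>+z. (\<Prod>b\<in>Basis. indicator (A' b) (z \<bullet> b)) \<partial>std_gaussian)"
    proof (rule nn_integral_cong)
      fix z :: 'a
      have "(\<Prod>b\<in>Basis. indicator (A' b) (z \<bullet> b) :: ennreal) = (\<Prod>k\<in>K. indicator (A k) (z \<bullet> e k))"
        by (subst prod.reindex_bij_betw[OF e, symmetric]) (simp add: A'e)
      also have "\<dots> = indicator ((\<lambda>z. \<lambda>k\<in>K. z \<bullet> e k) -` Pi\<^sub>E K A \<inter> space std_gaussian) z"
        using fin by (auto simp: indicator_def PiE_iff)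
      finally show "indicator ((\<lambda>z. \<lambda>k\<in>K. z \<bullet> e k) -` Pi\<^sub>E K A \<inter> space std_gaussian) z =
        (\<Prod>b\<in>Basis. indicator (A' b) (z \<bullet> b) :: ennreal)" by simp
    qed
    also have "\<dots> = (\<Prod>b\<in>Basis. \<integral>\<^sup>+x. ennreal (std_normal_density x) * indicator (A' b) x \<partial>lborel)"
      by (subst nn_integral_std_gaussian_prod) auto
    also have "\<dots> = (\<Prod>b\<in>Basis. emeasure std_normal (A' b))"
      by (intro prod.cong) (auto simp: std_normal_def emeasure_density)
    also have "\<dots> = (\<Prod>k\<in>K. emeasure std_normal (A k))"
      by (subst prod.reindex_bij_betw[OF e, symmetric]) (simp add: A'e)
    finally show "emeasure (distr std_gaussian (PiM K (\<lambda>_. borel)) (\<lambda>z. \<lambda>k\<in>K. z \<bullet> e k)) (Pi\<^sub>E K A) =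
        (\<Prod>k\<in>K. emeasure std_normal (A k))" .
  qed
  then show ?thesis by simp
qed

text \<open>A single index \<open>(c, i, j)\<close> for all real entries lets their joint law be one
  product measure; \<open>c\<close> selects the component of the quaternion.\<close>

definition quat_matrix_of :: "(nat \<times> 'm \<times> 'n \<Rightarrow> real) \<Rightarrow> quat^'n^'m" where
  "quat_matrix_of x = (\<chi> i j. Quat (x (0, i, j)) (x (1, i, j)) (x (2, i, j)) (x (3, i, j)))"

abbreviation (input) entry_indices :: "(nat \<times> 'm \<times> 'n) set" where
  "entry_indices \<equiv> {..<4} \<times> UNIV \<times> UNIV"

lemma lessThan_4: "{..<4::nat} = {0, 1, 2, 3}"
  by auto

lemma quat_matrix_of_measurable [measurable]:
  "(quat_matrix_of :: _ \<Rightarrow> quat^'n^'m) \<in> borel_measurable (PiM entry_indices (\<lambda>_. borel))"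
proof -
  have "(\<lambda>x. (quat_matrix_of x :: quat^'n^'m) \<bullet> b) \<in> borel_measurable (PiM entry_indices (\<lambda>_. borel))"
    if b: "b \<in> Basis" for b
  proof -
    obtain i j u where u: "b = axis i (axis j u)" "u \<in> Basis"
      using b by (auto simp: Basis_vec_def)
    have "(\<lambda>x. x (c, i, j)) \<in> borel_measurable (PiM entry_indices (\<lambda>_. borel))" if "c < 4" for c
      using that by (intro measurable_component_singleton) auto
    then show ?thesis
      using u by (auto simp: inner_axis quat_matrix_of_def inner_quat_def Basis_quat_def iq_def jq_def kq_def)
  qed
  then show ?thesis
    by (subst borel_measurable_euclidean_space) blast
qed

lemma bij_betw_row_indices:
  "bij_betw (\<lambda>(c, l, j). axis j ([1, iq, jq, kq] ! c)) ({..<4} \<times> {i} \<times> UNIV) (Basis :: (quat^'n) set)"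
  unfolding bij_betw_def
proof
  have "inj_on ((!) [1, iq, jq, kq]) {..<4}"
    by (auto simp: inj_on_def lessThan_4 quat_eq_iff iq_def jq_def kq_def numeral_2_eq_2 numeral_3_eq_3)
  moreover have "[1, iq, jq, kq] ! c \<noteq> 0" if "c < 4" for c
  proof -
    have "c \<in> {0, 1, 2, 3}"
      using that by auto
    then show ?thesis
      by (auto simp: quat_eq_iff iq_def jq_def kq_def numeral_2_eq_2 numeral_3_eq_3)
  qed
  ultimately show "inj_on (\<lambda>(c, l, j). axis j ([1, iq, jq, kq] ! c) :: quat^'n) ({..<4} \<times> {i} \<times> UNIV)"
    by (auto simp: inj_on_def axis_eq_axis)
  have "(!) [1, iq, jq, kq] ` {..<4} = Basis"
    by (auto simp: lessThan_4 Basis_quat_def numeral_2_eq_2 numeral_3_eq_3)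
  then have "Basis = (\<Union>j :: 'n. (\<lambda>c. axis j ([1, iq, jq, kq] ! c)) ` {..<4})"
    by (simp add: Basis_vec_def image_image[symmetric] full_SetCompr_eq flip: UN_simps) auto
  then show "(\<lambda>(c, l, j). axis j ([1, iq, jq, kq] ! c) :: quat^'n) ` ({..<4} \<times> {i} \<times> UNIV) = Basis"
    by (force simp: image_iff)
qed

text \<open>Tonelli with the indices split into \<open>K\<close> for row \<open>i\<close> and
  \<open>J\<close> for the others. For fixed \<open>J\<close>-coordinates the span is a fixed
  subspace and row \<open>i\<close> is a standard Gaussian vector, so the bound holds for every
  \<open>x\<close> and survives averaging.\<close>

lemma nn_integral_laplace_power_row_dist_le:
  fixes i :: "'m::finite"
  assumes dim: "4 * (CARD('m) - 1) + 2 * (p + 3) \<le> 4 * CARD('n::finite)"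
  shows "(\<integral>\<^sup>+x. laplace_power p ((row_dist (quat_matrix_of x :: quat^'n^'m) i)\<^sup>2) \<partial>PiM entry_indices (\<lambda>_. std_normal))
         \<le> ennreal (1 / (2 ^ (p + 1) * fact (p + 2)))" (is "?lhs \<le> ennreal ?C")
proof -
  interpret product_sigma_finite "\<lambda>_ :: nat \<times> 'm \<times> 'n. std_normal"
    by (intro product_sigma_finite.intro prob_space_imp_sigma_finite prob_space_std_normal)
  define J where "J = ({..<4} \<times> (UNIV - {i}) \<times> UNIV :: (nat \<times> 'm \<times> 'n) set)"
  define K where "K = ({..<4} \<times> {i} \<times> UNIV :: (nat \<times> 'm \<times> 'n) set)"
  define e :: "nat \<times> 'm \<times> 'n \<Rightarrow> quat^'n" where "e = (\<lambda>(c, l, j). axis j ([1, iq, jq, kq] ! c))"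
  have JK: "entry_indices = J \<union> K" "J \<inter> K = {}" "finite J" "finite K"
    by (auto simp: J_def K_def)
  have sets_eq [measurable_cong]: "sets (PiM L (\<lambda>_ :: nat \<times> 'm \<times> 'n. std_normal)) = sets (PiM L (\<lambda>_. borel))" for L
    by (simp cong: sets_PiM_cong)
  interpret J: prob_space "PiM J (\<lambda>_. std_normal)"
    by (intro prob_space_PiM prob_space_std_normal)
  let ?h = "\<lambda>x. laplace_power p ((row_dist (quat_matrix_of x :: quat^'n^'m) i)\<^sup>2)"
  have [measurable]: "?h \<in> borel_measurable (PiM (J \<union> K) (\<lambda>_. std_normal))"
    unfolding JK(1)[symmetric] by measurable
  have inner: "(\<integral>\<^sup>+y. ?h (merge J K (x, y)) \<partial>PiM K (\<lambda>_. std_normal)) \<le> ennreal ?C"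
    if x: "x \<in> space (PiM J (\<lambda>_. std_normal))" for x
  proof -
    \<comment> \<open>Outside \<open>J\<close> the family \<open>x\<close> has only default values;
      they fill row \<open>i\<close>, on which \<open>V\<close> does not depend.\<close>
    define V where "V = other_rows_span (quat_matrix_of x :: quat^'n^'m) i"
    have *: "row_dist (quat_matrix_of (merge J K (x, \<lambda>k\<in>K. z \<bullet> e k)) :: quat^'n^'m) i = infdist z V" for z
    proof -
      have "quat_matrix_of (merge J K (x, y)) $ l = (quat_matrix_of x :: quat^'n^'m) $ l" if "l \<noteq> i" for l y
        using that by (simp add: quat_matrix_of_def vec_eq_iff merge_def J_def)
      then have "other_rows_span (quat_matrix_of (merge J K (x, y)) :: quat^'n^'m) i = V" for y
        unfolding V_def by (intro other_rows_span_cong)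
      moreover have "quat_matrix_of (merge J K (x, \<lambda>k\<in>K. z \<bullet> e k)) $ i = z"
        by (simp add: quat_matrix_of_def vec_eq_iff merge_def J_def K_def e_def inner_axis inner_quat_def quat_eq_iff
            iq_def jq_def kq_def numeral_2_eq_2 numeral_3_eq_3)
      ultimately show ?thesis
        by (simp add: row_dist_def)
    qed
    have [measurable]: "(\<lambda>y. ?h (merge J K (x, y))) \<in> borel_measurable (PiM K (\<lambda>_. borel))"
      using x by measurable
    have "(\<integral>\<^sup>+y. ?h (merge J K (x, y)) \<partial>PiM K (\<lambda>_. std_normal)) =
        (\<integral>\<^sup>+y. ?h (merge J K (x, y)) \<partial>distr std_gaussian (PiM K (\<lambda>_. borel)) (\<lambda>z. \<lambda>k\<in>K. z \<bullet> e k))"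
      using bij_betw_row_indices[of i]
      by (subst PiM_std_normal_eq_distr_std_gaussian[of e]) (simp_all add: e_def K_def)
    also have "\<dots> = (\<integral>\<^sup>+z. ?h (merge J K (x, \<lambda>k\<in>K. z \<bullet> e k)) \<partial>std_gaussian)"
      by (rule nn_integral_distr) (auto intro!: measurable_restrict)
    also have "\<dots> = (\<integral>\<^sup>+z. laplace_power p ((infdist z V)\<^sup>2) \<partial>std_gaussian)"
      by (rule nn_integral_cong) (simp only: *)
    also have "\<dots> \<le> ennreal ?C"
    proof (rule nn_integral_std_gaussian_infdist_le)
      show "subspace V"
        unfolding V_def by (rule subspace_other_rows_span)
      show "dim V + 2 * (p + 3) \<le> DIM(quat^'n)"
        using dim dim_other_rows_span_le[of "quat_matrix_of x :: quat^'n^'m" i] by (simp add: V_def)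
    qed
    finally show ?thesis .
  qed
  have "?lhs = (\<integral>\<^sup>+x. \<integral>\<^sup>+y. ?h (merge J K (x, y)) \<partial>PiM K (\<lambda>_. std_normal) \<partial>PiM J (\<lambda>_. std_normal))"
    unfolding JK(1) by (rule product_nn_integral_fold) (use JK in auto)
  also have "\<dots> \<le> (\<integral>\<^sup>+x. ennreal ?C \<partial>PiM J (\<lambda>_. std_normal))"
    by (rule nn_integral_mono) (rule inner)
  also have "\<dots> = ennreal ?C"
    by (simp add: J.emeasure_space_1)
  finally show ?thesis .
qed

section \<open>Elementary inequalities and the tail bound\<close>

text \<open>Jensen's inequality with uniform weights; an even power is convex on the whole
  line.\<close>

lemma power_sum_le_even:
  fixes y :: "'i \<Rightarrow> real"
  assumes "even q" "finite I" "I \<noteq> {}"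
  shows "(\<Sum>i\<in>I. y i) ^ q * real (card I) \<le> real (card I) ^ q * (\<Sum>i\<in>I. y i ^ q)"
proof -
  have card: "real (card I) > 0"
    using assms by (simp add: card_gt_0_iff)
  have "(\<Sum>i\<in>I. (1 / card I) *\<^sub>R y i) ^ q \<le> (\<Sum>i\<in>I. (1 / card I) * y i ^ q)"
    using assms card by (intro convex_on_sum[OF _ _ convex_power_even[OF assms(1)]]) auto
  then have "(\<Sum>i\<in>I. y i) ^ q / real (card I) ^ q \<le> (\<Sum>i\<in>I. y i ^ q) / real (card I)"
    by (simp add: power_divide flip: sum_divide_distrib)
  then show ?thesis
    using card by (simp add: field_simps)
qed

text \<open>From \<open>N\<close> to \<open>Suc N\<close> the left side grows by the factor
  \<open>(1 + 1 / (N + 2)) ^ (N + 1) * (N + 2) / 3\<close>. This is at most \<open>N + 2\<close>,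
  because \<open>1 + x \<le> exp x\<close> and \<open>exp 1 \<le> 3\<close>.\<close>

lemma third_power_le_fact: "((real N + 2) / 3) ^ N \<le> fact (N + 1)"
proof (induction N)
  case (Suc N)
  have "(1 + 1 / (real N + 2)) ^ Suc N \<le> exp (1 / (real N + 2)) ^ Suc N"
    by (intro power_mono) auto
  also have "\<dots> = exp (real (Suc N) * (1 / (real N + 2)))"
    by (rule exp_of_nat_mult[symmetric])
  also have "\<dots> \<le> exp 1"
    by (simp add: field_simps)
  also have "\<dots> \<le> 3"
    by (rule exp_le)
  finally have b: "(1 + 1 / (real N + 2)) ^ Suc N \<le> 3" .
  have "(real (Suc N) + 2) / 3 = (1 + 1 / (real N + 2)) * ((real N + 2) / 3)"
    by (simp add: field_simps)
  then have "((real (Suc N) + 2) / 3) ^ Suc N = (1 + 1 / (real N + 2)) ^ Suc N * ((real N + 2) / 3) * ((real N + 2) / 3) ^ N"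
    by (simp only: power_mult_distrib power_Suc mult_ac)
  also have "\<dots> \<le> 3 * ((real N + 2) / 3) * fact (N + 1)"
    using b Suc by (intro mult_mono) auto
  also have "\<dots> = fact (Suc N + 1)"
    by (simp add: algebra_simps)
  finally show ?case .
qed simp

text \<open>A pointwise majorant for Markov's inequality. Where a row distance vanishes the right
  side is infinite; elsewhere it follows from Jensen's inequality for the even exponent
  \<open>Suc p\<close>.\<close>

lemma frobenius_norm_pseudoinverse_laplace_bound:
  fixes A :: "quat^'n^'m"
  assumes a: "a > 0" "(frobenius_norm (pseudoinverse A))\<^sup>2 > a" and p: "odd p"
  shows "1 \<le> ennreal (real CARD('m) ^ p / a ^ Suc p) * (\<Sum>i\<in>UNIV. laplace_power p ((row_dist A i)\<^sup>2))"
proof (cases "\<exists>i. row_dist A i = 0")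
  case True
  then obtain i where "row_dist A i = 0" ..
  then have "laplace_power p ((row_dist A i)\<^sup>2) = \<infinity>"
    by (simp add: laplace_power_zero)
  then have "(\<Sum>i\<in>UNIV. laplace_power p ((row_dist A i)\<^sup>2)) = \<infinity>"
    by auto
  \<comment> \<open>In \<open>ennreal\<close> zero times infinity is zero, so the factor must be
    nonzero.\<close>
  moreover have "ennreal (real CARD('m) ^ p / a ^ Suc p) \<noteq> 0"
    using a by simp
  ultimately have "ennreal (real CARD('m) ^ p / a ^ Suc p) * (\<Sum>i\<in>UNIV. laplace_power p ((row_dist A i)\<^sup>2)) = top"
    by (simp only: ennreal_mult_eq_top_iff infinity_ennreal_def) blast
  then show ?thesis
    by (simp only: top_greatest)
next
  case False
  then have pos: "row_dist A i > 0" for i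
    using row_dist_nonneg[of A i] by (metis less_eq_real_def)
  have "a ^ Suc p * real CARD('m) \<le> (\<Sum>i\<in>UNIV. 1 / (row_dist A i)\<^sup>2) ^ Suc p * real CARD('m)"
    using a frobenius_norm_pseudoinverse_le[OF pos] by (intro mult_right_mono power_mono) auto
  also have "\<dots> \<le> real CARD('m) ^ Suc p * (\<Sum>i\<in>UNIV. (1 / (row_dist A i)\<^sup>2) ^ Suc p)"
    using p by (intro power_sum_le_even) auto
  finally have "1 \<le> real CARD('m) ^ p / a ^ Suc p * (\<Sum>i\<in>UNIV. (1 / (row_dist A i)\<^sup>2) ^ Suc p)"
    using a by (simp add: field_simps)
  then have "ennreal 1 \<le> ennreal (real CARD('m) ^ p / a ^ Suc p * (\<Sum>i\<in>UNIV. (1 / (row_dist A i)\<^sup>2) ^ Suc p))"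
    by (rule ennreal_leI)
  also have "\<dots> = ennreal (real CARD('m) ^ p / a ^ Suc p) * (\<Sum>i\<in>UNIV. ennreal ((1 / (row_dist A i)\<^sup>2) ^ Suc p))"
    using a by (subst ennreal_mult) (auto intro!: sum_nonneg simp: sum_ennreal)
  also have "(\<Sum>i\<in>UNIV. ennreal ((1 / (row_dist A i)\<^sup>2) ^ Suc p)) = (\<Sum>i\<in>UNIV. laplace_power p ((row_dist A i)\<^sup>2))"
    using pos by (intro sum.cong refl) (simp add: laplace_power_pos[OF zero_less_power[OF pos]] power_one_over)
  finally show ?thesis by simp
qed

theorem theorem6:
  fixes M :: "'a measure"
    and G0 G1 G2 G3 :: "'a \<Rightarrow> real^'n^'m"
    and t :: real
  assumes "prob_space M"
    and dim: "int CARD('n) - int CARD('m) \<ge> 1"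
    and indep: "prob_space.indep_vars M (\<lambda>_. borel)
        (\<lambda>(c, i, j) \<omega>. ([G0, G1, G2, G3] ! c) \<omega> $ i $ j)
        ({..<4} \<times> (UNIV :: 'm set) \<times> (UNIV :: 'n set))"
    and normal: "\<And>c i j. c < 4 \<Longrightarrow>
        distributed M lborel (\<lambda>\<omega>. ([G0, G1, G2, G3] ! c) \<omega> $ i $ j) std_normal_density"
    and t: "t \<ge> 1"
  shows "\<P>(\<omega> in M.
           (frobenius_norm (pseudoinverse (quat_matrix (G0 \<omega>) (G1 \<omega>) (G2 \<omega>) (G3 \<omega>))))\<^sup>2
             > 3 * real CARD('m) / (4 * (real CARD('n) - real CARD('m) + 1)) * t)
         \<le> t powr (- 2 * (real CARD('n) - real CARD('m)))"
proof -
  interpret M: prob_space M by fact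
  define I where "I = (entry_indices :: (nat \<times> 'm \<times> 'n) set)"
  define X where "X = (\<lambda>(c, i :: 'm, j :: 'n) \<omega>. ([G0, G1, G2, G3] ! c) \<omega> $ i $ j)"
  define Y where "Y \<omega> = (\<lambda>k\<in>I. X k \<omega>)" for \<omega>
  define r where "r = CARD('n) - CARD('m)"
  \<comment> \<open>Chosen so that the moment order \<open>Suc p\<close> is \<open>2 * r\<close>,
    the exponent of \<open>t\<close>; it is odd because \<open>r \<ge> 1\<close>.\<close>
  define p where "p = 2 * r - 1"
  define m where "m = real CARD('m)"
  define a where "a = 3 * m / (4 * (real r + 1)) * t"
  have r: "r \<ge> 1" "real CARD('n) - real CARD('m) = real r" "CARD('n) = CARD('m) + r"
    using dim by (auto simp: r_def)
  have p: "odd p" "Suc p = 2 * r"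
    using r by (auto simp: p_def)
  have m: "m > 0"
    by (simp add: m_def)
  have a: "a > 0"
    using t m by (simp add: a_def)
  have X_distr: "distr M borel (X k) = std_normal" and X_meas: "X k \<in> borel_measurable M" if k: "k \<in> I" for k
  proof -
    obtain c i j where k: "k = (c, i, j)" "c < 4"
      using k by (auto simp: I_def)
    then have d: "distributed M lborel (X k) std_normal_density"
      using normal by (simp add: X_def)
    then show "X k \<in> borel_measurable M"
      by (simp add: distributed_def)
    \<comment> \<open>Densities are stated relative to \<open>lborel\<close> and independence
      relative to \<open>borel\<close>; the sigma-algebras coincide.\<close>
    have "distr M borel (X k) = distr M lborel (X k)"
      by (rule distr_cong) auto
    also have "\<dots> = std_normal"
      using d by (simp add: distributed_def std_normal_def)
    finally show "distr M borel (X k) = std_normal" .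
  qed
  have Y_meas [measurable]: "Y \<in> M \<rightarrow>\<^sub>M PiM I (\<lambda>_. borel)"
    unfolding Y_def using X_meas by (intro measurable_restrict) auto
  have "distr M (PiM I (\<lambda>_. borel)) Y = PiM I (\<lambda>k. distr M borel (X k))"
    unfolding Y_def
  proof (rule M.indep_vars_iff_distr_eq_PiM'[THEN iffD1])
    show "I \<noteq> {}"
      unfolding I_def by (auto simp: lessThan_4)
    show "M.indep_vars (\<lambda>_. borel) X I"
      using indep by (simp add: X_def I_def)
  qed (rule X_meas)
  also have "\<dots> = PiM I (\<lambda>_. std_normal)"
    by (rule PiM_cong) (auto simp: X_distr)
  finally have Y_distr: "distr M (PiM I (\<lambda>_. borel)) Y = PiM I (\<lambda>_. std_normal)" .
  have Y_matrix: "quat_matrix (G0 \<omega>) (G1 \<omega>) (G2 \<omega>) (G3 \<omega>) = quat_matrix_of (Y \<omega>)" for \<omega>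
    by (simp add: quat_matrix_def quat_matrix_of_def Y_def X_def I_def numeral_2_eq_2 numeral_3_eq_3)
  define D where "D \<omega> i = laplace_power p ((row_dist (quat_matrix_of (Y \<omega>) :: quat^'n^'m) i)\<^sup>2)" for \<omega> i
  have Q [measurable]: "(quat_matrix_of :: _ \<Rightarrow> quat^'n^'m) \<in> borel_measurable (PiM I (\<lambda>_. borel))"
    unfolding I_def by (rule quat_matrix_of_measurable)
  have [measurable]: "(\<lambda>\<omega>. D \<omega> i) \<in> borel_measurable M" for i
    unfolding D_def by measurable
  have D_le: "(\<integral>\<^sup>+\<omega>. D \<omega> i \<partial>M) \<le> ennreal (1 / (2 ^ (p + 1) * fact (p + 2)))" for i
  proof -
    have "(\<integral>\<^sup>+\<omega>. D \<omega> i \<partial>M) =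
      (\<integral>\<^sup>+x. laplace_power p ((row_dist (quat_matrix_of x :: quat^'n^'m) i)\<^sup>2) \<partial>distr M (PiM I (\<lambda>_. borel)) Y)"
      unfolding D_def by (subst nn_integral_distr) auto
    also have "\<dots> = (\<integral>\<^sup>+x. laplace_power p ((row_dist (quat_matrix_of x :: quat^'n^'m) i)\<^sup>2) \<partial>PiM entry_indices (\<lambda>_. std_normal))"
      unfolding Y_distr by (simp only: I_def)
    also have "\<dots> \<le> ennreal (1 / (2 ^ (p + 1) * fact (p + 2)))"
    proof (rule nn_integral_laplace_power_row_dist_le)
      \<comment> \<open>With \<open>2 * (p + 3) = 4 * (r + 1)\<close> the dimension condition holds
        with equality. The bound on \<open>CARD('m)\<close> keeps the natural subtraction
        exact.\<close>
      have "CARD('m) \<ge> 1"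
        by (simp add: Suc_leI)
      then show "4 * (CARD('m) - 1) + 2 * (p + 3) \<le> 4 * CARD('n)"
        using p(2) r(3) by (simp add: diff_mult_distrib2)
    qed
    finally show ?thesis .
  qed
  define c where "c = m ^ p / a ^ Suc p"
  have "emeasure M {\<omega>\<in>space M. (frobenius_norm (pseudoinverse (quat_matrix_of (Y \<omega>) :: quat^'n^'m)))\<^sup>2 > a}
      \<le> emeasure M {\<omega>\<in>space M. 1 \<le> ennreal c * (\<Sum>i\<in>UNIV. D \<omega> i)}"
  proof (rule emeasure_mono)
    show "{\<omega>\<in>space M. (frobenius_norm (pseudoinverse (quat_matrix_of (Y \<omega>) :: quat^'n^'m)))\<^sup>2 > a}
        \<subseteq> {\<omega>\<in>space M. 1 \<le> ennreal c * (\<Sum>i\<in>UNIV. D \<omega> i)}"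
      using frobenius_norm_pseudoinverse_laplace_bound[OF a _ p(1)] unfolding D_def c_def m_def by blast
  qed measurable
  also have "\<dots> \<le> ennreal c * (\<integral>\<^sup>+\<omega>. (\<Sum>i\<in>UNIV. D \<omega> i) * indicator (space M) \<omega> \<partial>M)"
    by (rule nn_integral_Markov_inequality) measurable
  also have "\<dots> = ennreal c * (\<Sum>i\<in>UNIV. \<integral>\<^sup>+\<omega>. D \<omega> i \<partial>M)"
    by (subst nn_integral_sum[symmetric]) (auto intro!: arg_cong2[where f = "(*)"] nn_integral_cong)
  also have "\<dots> \<le> ennreal c * (\<Sum>i\<in>(UNIV :: 'm set). ennreal (1 / (2 ^ (p + 1) * fact (p + 2))))"
    by (intro mult_left_mono sum_mono D_le) auto
  also have "\<dots> = ennreal (c * (m * (1 / (2 ^ (p + 1) * fact (p + 2)))))"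
  proof -
    have "c \<ge> 0"
      using m a by (simp add: c_def)
    then show ?thesis
      using m by (simp only: sum_constant ennreal_of_nat_eq_real_of_nat m_def[symmetric])
        (simp flip: ennreal_mult)
  qed
  also have "\<dots> \<le> ennreal (t powr (- 2 * real r))"
  proof (rule ennreal_leI)
    have "c * (m * (1 / (2 ^ (p + 1) * fact (p + 2)))) = (m / a) ^ (2 * r) / (2 ^ (2 * r) * fact (2 * r + 1))"
      using p by (simp add: c_def power_divide flip: p(2))
    \<comment> \<open>The factor \<open>2\<close> cancels the power of two in the moment bound, and
      what is left has the form of \<open>third_power_le_fact\<close> with
      \<open>N = 2 * r\<close>.\<close>
    also have "m / a = 2 * ((real (2 * r) + 2) / 3) / t"
      using m t by (simp add: a_def field_simps)
    also have "(2 * ((real (2 * r) + 2) / 3) / t) ^ (2 * r) / (2 ^ (2 * r) * fact (2 * r + 1)) =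
        (((real (2 * r) + 2) / 3) ^ (2 * r) / fact (2 * r + 1)) * (1 / t ^ (2 * r))"
      by (simp only: power_divide[of _ t] power_mult_distrib) simp
    also have "\<dots> \<le> 1 * (1 / t ^ (2 * r))"
      using third_power_le_fact[of "2 * r"] t by (intro mult_right_mono) (auto simp: divide_le_eq_1)
    also have "\<dots> = t powr (- 2 * real r)"
      using t powr_realpow[of t "2 * r"] by (simp add: powr_minus_divide)
    finally show "c * (m * (1 / (2 ^ (p + 1) * fact (p + 2)))) \<le> t powr (- 2 * real r)" .
  qed
  finally have "measure M {\<omega>\<in>space M. (frobenius_norm (pseudoinverse (quat_matrix_of (Y \<omega>) :: quat^'n^'m)))\<^sup>2 > a}
      \<le> t powr (- 2 * real r)"
    by (simp add: M.emeasure_eq_measure)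
  then show ?thesis
    by (simp only: Y_matrix r(2) a_def m_def)
qed

end
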